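(* Let $G$ be a graph, $F$ a forest of $G$, and $e_1=\overrightarrow{u_1v_1}<\cdots<e_h=\overrightarrow{u_hv_h}$ an orientation and ordering of the edges not in $F$. For a connected subgraph $H$ of $G$, let $\varphi_H$ be the map from spanning trees of $H$ to divisors on $H$ defined by: for each edge $f$ of $H$ not in $T$, let $C$ be the unique cycle in $T+f$, let $i$ be the smallest index with $e_i\in C$, orient $C$ so that it traverses $e_i$ from $u_i$ to $v_i$, orient $f$ as it is traversed by $C$, and add one chip at the head of $f$; $\varphi_H(T)$ is the sum of these chips. Define recursively $\mathrm{Inv}(H,D)$, for $H$ a connected subgraph of $G$ and $D$ a break divisor of $H$: (a) if $D=0$, return $T:=E(H)$; (b) otherwise let $i$ be the smallest index with $e_i\in E(H)$; let $\mathcal{O}$ be a $v_i$-connected orientation of $H$ with $D=D_{\mathcal{O}}+(v_i)$; let $U$ be the set of vertices reachable from $u_i$ by a directed path in $\mathcal{O}$ (including $u_i$); (b1) if $v_i\in U$, return $\mathrm{Inv}(H-e_i,\,D-(v_i))$; (b2) if $v_i\notin U$, let $D_R$ be the restriction of $D$ to $V(H)\setminus U$, let $D_L$ be the restriction of $D$ to $U$ minus $(u)$ for every edge $f\neq e_i$ of $H$ directed in $\mathcal{O}$ from a vertex outside $U$ to a vertex $u\in U$, and return $\{e_i\}\cup\mathrm{Inv}(H[U],D_L)\cup\mathrm{Inv}(H[V(H)\setminus U],D_R)$, where $H[\cdot]$ denotes the induced subgraph. Then for every connected subgraph $H$ of $G$ and every break divisor $D$ of $H$, this recursion is well defined and terminates,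 and $\mathrm{Inv}(H,\cdot)$ is the inverse of $\varphi_H$: it returns a spanning tree $T$ of $H$ with $\varphi_H(T)=D$, and $\varphi_H$ is a bijection from spanning trees of $H$ onto break divisors of $H$ with inverse $\mathrm{Inv}(H,\cdot)$.
   Context: Graphs are finite, possibly with parallel edges but without loops; cycles are simple. A divisor on $H$ is a function $V(H)\to\mathbb{Z}$, written as a formal sum of vertices $(v)$. For a connected graph $H$ of genus $g_H=|E(H)|-|V(H)|+1$, a break divisor is a divisor obtained by choosing a spanning tree $T$ of $H$ and, for each edge not in $T$, adding one chip at one of its endpoints (so the zero divisor is a break divisor exactly when $H$ is a tree). For an orientation $\mathcal{O}$ of $H$ (every edge directed), $D_{\mathcal{O}}=\sum_{v}(\mathrm{indeg}_{\mathcal{O}}(v)-1)(v)$; $\mathcal{O}$ is $q$-connected if every vertex is reachable from $q$ by a directed path. It is known that for any break divisor $D$ of $H$ and vertex $q$ there is a $q$-connected orientation $\mathcal{O}$ with $D=D_{\mathcal{O}}+(q)$ (computable by Backman's algorithm), which is the subroutine used in step (b). *)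

theory Defs
  imports "Graph_Theory.Digraph_Component" "HOL-Library.Function_Algebras"
begin

text \<open>
  Undirected multigraphs. The digraphs of Graph_Theory serve for orientations, directed
  reachability, in-degrees and walks, but its trees and forests are not used: there, connectedness
  ignores arc directions whereas acyclicity refers to directed cycles.
\<close>

record ('v, 'e) mgraph =
  nodes :: "'v set"
  edges :: "'e set"
  ends :: "'e \<Rightarrow> 'v set"

locale multigraph =
  fixes G :: "('v, 'e) mgraph"
  assumes finite_nodes: "finite (nodes G)"
    and finite_edges: "finite (edges G)"
    and ends_in_nodes: "e \<in> edges G \<Longrightarrow> ends G e \<subseteq> nodes G"
    and no_loops: "e \<in> edges G \<Longrightarrow> card (ends G e) = 2"

text \<open>
  As in \<^const>\<open>compatible\<close>, the incidence function of a subgraph is that of the ambient graph; its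
  values outside the edge set are irrelevant.
\<close>
definition sub_multigraph :: "('v, 'e) mgraph \<Rightarrow> ('v, 'e) mgraph \<Rightarrow> bool" where
  "sub_multigraph H G \<longleftrightarrow> multigraph H \<and> multigraph G \<and>
     nodes H \<subseteq> nodes G \<and> edges H \<subseteq> edges G \<and> ends H = ends G"

definition induced :: "('v, 'e) mgraph \<Rightarrow> 'v set \<Rightarrow> ('v, 'e) mgraph" where
  "induced H U = H\<lparr>nodes := U, edges := {e \<in> edges H. ends H e \<subseteq> U}\<rparr>"

definition delete_edge :: "('v, 'e) mgraph \<Rightarrow> 'e \<Rightarrow> ('v, 'e) mgraph" where
  "delete_edge H e = H\<lparr>edges := edges H - {e}\<rparr>"

text \<open>
  A dart \<open>(x, e, y)\<close> is the edge \<open>e\<close> together with the direction from \<open>x\<close> to \<open>y\<close>. Walks in an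
  undirected graph are directed walks in its digraph of darts.
\<close>
type_synonym ('v, 'e) dart = "'v \<times> 'e \<times> 'v"

abbreviation dart_edge :: "('v, 'e) dart \<Rightarrow> 'e" where
  "dart_edge d \<equiv> fst (snd d)"

definition dart_digraph :: "('v, 'e) mgraph \<Rightarrow> ('v, ('v, 'e) dart) pre_digraph" where
  "dart_digraph H =
     \<lparr>verts = nodes H,
      arcs = {(x, e, y). e \<in> edges H \<and> ends H e = {x, y}},
      tail = (\<lambda>(x, e, y). x),
      head = (\<lambda>(x, e, y). y)\<rparr>"

text \<open>Connected graphs are nonempty, by the definition of \<^const>\<open>strongly_connected\<close>.\<close>
definition connected_graph :: "('v, 'e) mgraph \<Rightarrow> bool" where
  "connected_graph H \<longleftrightarrow> strongly_connected (dart_digraph H)"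

text \<open>
  A simple cycle with a direction of traversal. Distinctness of the edges excludes going back and
  forth along one edge; two parallel edges do form a cycle.
\<close>
definition directed_cycle :: "('v, 'e) mgraph \<Rightarrow> ('v, 'e) dart list \<Rightarrow> bool" where
  "directed_cycle H p \<longleftrightarrow> pre_digraph.cycle (dart_digraph H) p \<and> distinct (map dart_edge p)"

text \<open>Forests and spanning trees are identified with their edge sets.\<close>
definition forest_of :: "('v, 'e) mgraph \<Rightarrow> 'e set \<Rightarrow> bool" where
  "forest_of G F \<longleftrightarrow> F \<subseteq> edges G \<and> (\<nexists>p. directed_cycle (G\<lparr>edges := F\<rparr>) p)"

definition spanning_tree_of :: "('v, 'e) mgraph \<Rightarrow> 'e set \<Rightarrow> bool" where
  "spanning_tree_of H T \<longleftrightarrow> forest_of H T \<and> connected_graph (H\<lparr>edges := T\<rparr>)"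

text \<open>Divisors on \<open>H\<close> are extended by \<open>0\<close> outside \<^term>\<open>nodes H\<close>.\<close>
type_synonym 'v divisor = "'v \<Rightarrow> int"

definition chip :: "'v \<Rightarrow> 'v divisor" where
  "chip v = (\<lambda>x. if x = v then 1 else 0)"

definition restrict_divisor :: "'v divisor \<Rightarrow> 'v set \<Rightarrow> 'v divisor" where
  "restrict_divisor D U = (\<lambda>x. if x \<in> U then D x else 0)"

definition break_divisor :: "('v, 'e) mgraph \<Rightarrow> 'v divisor \<Rightarrow> bool" where
  "break_divisor H D \<longleftrightarrow>
     (\<exists>T c. spanning_tree_of H T \<and> (\<forall>f \<in> edges H - T. c f \<in> ends H f) \<and>
            D = (\<Sum>f \<in> edges H - T. chip (c f)))"

definition orientation_of :: "('v, 'e) mgraph \<Rightarrow> ('v, 'e) pre_digraph \<Rightarrow> bool" where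
  "orientation_of H \<O> \<longleftrightarrow> verts \<O> = nodes H \<and> arcs \<O> = edges H \<and>
     (\<forall>e \<in> edges H. ends H e = {tail \<O> e, head \<O> e})"

definition orientation_divisor :: "('v, 'e) pre_digraph \<Rightarrow> 'v divisor" where
  "orientation_divisor \<O> = (\<lambda>v. if v \<in> verts \<O> then int (in_degree \<O> v) - 1 else 0)"

definition reachable_set :: "('v, 'e) pre_digraph \<Rightarrow> 'v \<Rightarrow> 'v set" where
  "reachable_set \<O> u = {x. u \<rightarrow>\<^sup>*\<^bsub>\<O>\<^esub> x}"

definition root_connected :: "('v, 'e) pre_digraph \<Rightarrow> 'v \<Rightarrow> bool" where
  "root_connected \<O> q \<longleftrightarrow> (\<forall>x \<in> verts \<O>. q \<rightarrow>\<^sup>*\<^bsub>\<O>\<^esub> x)"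

text \<open>
  The oriented edges \<open>e\<^sub>1 < \<dots> < e\<^sub>h\<close> outside \<open>F\<close>, as a list in increasing order; the \<open>i\<close>-th entry
  is \<open>(u\<^sub>i, e\<^sub>i, v\<^sub>i)\<close>.
\<close>
definition oriented_enumeration ::
  "('v, 'e) mgraph \<Rightarrow> 'e set \<Rightarrow> ('v, 'e) dart list \<Rightarrow> bool" where
  "oriented_enumeration G F es \<longleftrightarrow>
     set es \<subseteq> arcs (dart_digraph G) \<and> distinct (map dart_edge es) \<and>
     set (map dart_edge es) = edges G - F"

definition first_dart :: "('v, 'e) dart list \<Rightarrow> 'e set \<Rightarrow> ('v, 'e) dart option" where
  "first_dart es X = find (\<lambda>d. dart_edge d \<in> X) es"

text \<open>
  The head of \<open>f\<close> when the cycle of \<open>T + f\<close> is traversed so that its first dart lies on it;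
  the starting point of the closed walk \<open>p\<close> is immaterial.
\<close>
definition chip_vertex :: "('v, 'e) dart list \<Rightarrow> ('v, 'e) mgraph \<Rightarrow> 'e set \<Rightarrow> 'e \<Rightarrow> 'v" where
  "chip_vertex es H T f =
     (THE y. \<exists>p d x. directed_cycle (H\<lparr>edges := insert f T\<rparr>) p \<and>
        first_dart es (dart_edge ` set p) = Some d \<and> d \<in> set p \<and> (x, f, y) \<in> set p)"

definition tree_divisor ::
  "('v, 'e) dart list \<Rightarrow> ('v, 'e) mgraph \<Rightarrow> 'e set \<Rightarrow> 'v divisor" (\<open>\<phi>\<close>) where
  "\<phi> es H T = (\<Sum>f \<in> edges H - T. chip (chip_vertex es H T f))"

text \<open>
  The recursion leaves the choice of the orientation \<open>\<O>\<close> open, so it is modelled as a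
  nondeterministic program: \<open>inv_choice\<close> describes the admissible choices, \<open>inv_b1\<close> and \<open>inv_b2\<close>
  the recursive calls made after such a choice, and \<open>inv_returns\<close> the possible results.
\<close>
definition inv_choice :: "('v, 'e) dart list \<Rightarrow> ('v, 'e) mgraph \<Rightarrow> 'v divisor \<Rightarrow>
    ('v, 'e) dart \<Rightarrow> ('v, 'e) pre_digraph \<Rightarrow> bool" where
  "inv_choice es H D = (\<lambda>(u, e, v) \<O>.
     D \<noteq> 0 \<and> first_dart es (edges H) = Some (u, e, v) \<and>
     orientation_of H \<O> \<and> root_connected \<O> v \<and> D = orientation_divisor \<O> + chip v)"

definition inv_b1 :: "('v, 'e) dart list \<Rightarrow> ('v, 'e) mgraph \<Rightarrow> 'v divisor \<Rightarrow>
    ('v, 'e) mgraph \<Rightarrow> 'v divisor \<Rightarrow> bool" where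
  "inv_b1 es H D H' D' \<longleftrightarrow>
     (\<exists>u e v \<O>. inv_choice es H D (u, e, v) \<O> \<and> v \<in> reachable_set \<O> u \<and>
        H' = delete_edge H e \<and> D' = D - chip v)"

definition inv_b2 :: "('v, 'e) dart list \<Rightarrow> ('v, 'e) mgraph \<Rightarrow> 'v divisor \<Rightarrow> 'e \<Rightarrow>
    ('v, 'e) mgraph \<Rightarrow> 'v divisor \<Rightarrow> ('v, 'e) mgraph \<Rightarrow> 'v divisor \<Rightarrow> bool" where
  "inv_b2 es H D e H\<^sub>L D\<^sub>L H\<^sub>R D\<^sub>R \<longleftrightarrow>
     (\<exists>u v \<O> U. inv_choice es H D (u, e, v) \<O> \<and> U = reachable_set \<O> u \<and> v \<notin> U \<and>
        H\<^sub>L = induced H U \<and>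
        D\<^sub>L = restrict_divisor D U -
          (\<Sum>f \<in> {f \<in> edges H. f \<noteq> e \<and> tail \<O> f \<notin> U \<and> head \<O> f \<in> U}. chip (head \<O> f)) \<and>
        H\<^sub>R = induced H (nodes H - U) \<and>
        D\<^sub>R = restrict_divisor D (nodes H - U))"

inductive inv_returns ::
    "('v, 'e) dart list \<Rightarrow> ('v, 'e) mgraph \<Rightarrow> 'v divisor \<Rightarrow> 'e set \<Rightarrow> bool"
  for es :: "('v, 'e) dart list" where
  zero: "inv_returns es H 0 (edges H)"
| b1: "inv_b1 es H D H' D' \<Longrightarrow> inv_returns es H' D' T \<Longrightarrow> inv_returns es H D T"
| b2: "inv_b2 es H D e H\<^sub>L D\<^sub>L H\<^sub>R D\<^sub>R \<Longrightarrow> inv_returns es H\<^sub>L D\<^sub>L T\<^sub>L \<Longrightarrow> inv_returns es H\<^sub>R D\<^sub>R T\<^sub>R \<Longrightarrow>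
       inv_returns es H D ({e} \<union> T\<^sub>L \<union> T\<^sub>R)"

text \<open>\<open>inv_call es y x\<close>: evaluating the recursion at \<open>x\<close> may directly call it at \<open>y\<close>.\<close>
definition inv_call :: "('v, 'e) dart list \<Rightarrow>
    ('v, 'e) mgraph \<times> 'v divisor \<Rightarrow> ('v, 'e) mgraph \<times> 'v divisor \<Rightarrow> bool" where
  "inv_call es = (\<lambda>(H', D') (H, D).
     inv_b1 es H D H' D' \<or>
     (\<exists>e H'' D''. inv_b2 es H D e H' D' H'' D'' \<or> inv_b2 es H D e H'' D'' H' D'))"

text \<open>The function computed by the recursion; meaningful where the result is unique.\<close>
definition Inv :: "('v, 'e) dart list \<Rightarrow> ('v, 'e) mgraph \<Rightarrow> 'v divisor \<Rightarrow> 'e set" where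
  "Inv es H D = (THE T. inv_returns es H D T)"

text \<open>
  Well-definedness and termination at the argument \<open>(H, D)\<close>, for all choices of orientations:
  unless \<open>D = 0\<close> an orientation can be chosen, every call is again made at a connected subgraph of
  \<open>G\<close> and a break divisor of it, there is no infinite chain of calls, and exactly one result can
  be returned.
\<close>
definition inv_well_defined :: "('v, 'e) mgraph \<Rightarrow> ('v, 'e) dart list \<Rightarrow>
    ('v, 'e) mgraph \<Rightarrow> 'v divisor \<Rightarrow> bool" where
  "inv_well_defined G es H D \<longleftrightarrow>
     (D \<noteq> 0 \<longrightarrow> (\<exists>d \<O>. inv_choice es H D d \<O>)) \<and>
     (\<forall>H' D'. inv_call es (H', D') (H, D) \<longrightarrow>
        sub_multigraph H' G \<and> connected_graph H' \<and> break_divisor H' D') \<and>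
     Wellfounded.accp (inv_call es) (H, D) \<and>
     (\<exists>!T. inv_returns es H D T)"

end

theory Submission
  imports Defs
begin

text \<open>
  Root a spanning tree \<open>T\<close> at a vertex \<open>q\<close>, orient its edges away from \<open>q\<close> and every other edge towards
  its chip: this is a \<open>q\<close>-connected orientation \<open>O\<close> whose divisor plus \<open>(q)\<close> is the break divisor of the
  chips. Conversely a \<open>q\<close>-connected orientation contains a spanning arborescence rooted at \<open>q\<close>. Hence
  for every \<open>q\<close> the break divisors are exactly the \<open>D\<^sub>O + (q)\<close> with \<open>O\<close> \<open>q\<close>-connected, and the
  divisors of the recursive calls are of this form for the restricted orientations.

  Orientations with the same divisor have the same reachable sets, so for \<open>D = \<phi>(T)\<close> the set \<open>U\<close> of
  the algorithm can be computed in the orientation built from \<open>T\<close> and its chips with root \<open>v\<^sub>i\<close>.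
  There \<open>v\<^sub>i\<close> lies in \<open>U\<close> iff \<open>e\<^sub>i\<close> is not in \<open>T\<close>, and otherwise \<open>U\<close> is the side of \<open>u\<^sub>i\<close> in the
  fundamental cut of \<open>e\<^sub>i\<close>: all other edges of this cut receive their chip on that side, because
  their cycle starts with \<open>e\<^sub>i\<close>. Thus the recursion takes \<open>T\<close> apart correctly and returns it.
\<close>

section \<open>Connectivity, cycles and forests\<close>

text \<open>Two inductions along \<open>inv_returns\<close> carry the theorem, and no count of break
  divisors against spanning trees is involved: every result for a break divisor \<open>D\<close> is
  a tree mapped to \<open>D\<close>, and every result for the divisor of a tree \<open>T\<close> is
  \<open>T\<close> itself. The second statement, applied to a result of the first, makes results
  independent of the chosen orientations. The obstacle is that a cycle is a list of darts,
  determined only up to starting point and direction, while the place of a chip depends on the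
  direction. Paths in trees are therefore never compared. Each tree edge \<open>e\<close> splits the
  vertices into two sides, and a cycle of \<open>T + f\<close> that leaves a side along
  \<open>e\<close> has only \<open>f\<close> to come back, since it uses every edge once. This
  crossing argument yields uniqueness of the edge set of the cycle and the place of the chips. The
  forest \<open>F\<close> guarantees that every cycle contains an enumerated edge, so that a
  direction is always prescribed.\<close>

lemma multigraph_ends:
  assumes "multigraph H" "e \<in> edges H"
  obtains x y where "ends H e = {x, y}" "x \<noteq> y" "x \<in> nodes H" "y \<in> nodes H"
  using multigraph.no_loops[OF assms] multigraph.ends_in_nodes[OF assms]
  by (auto simp: card_2_iff)

lemma multigraph_other_end:
  assumes "multigraph H" "e \<in> edges H" "x \<in> ends H e"
  obtains y where "ends H e = {y, x}" "x \<noteq> y" "x \<in> nodes H" "y \<in> nodes H"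
proof -
  obtain a b where "ends H e = {a, b}" "a \<noteq> b" "a \<in> nodes H" "b \<in> nodes H"
    by (rule multigraph_ends[OF assms(1,2)])
  then show ?thesis using assms(3) that[of a] that[of b] by (auto simp: insert_commute)
qed

lemma multigraph_ends_neq:
  assumes "multigraph H" "e \<in> edges H" "ends H e = {x, y}"
  shows "x \<noteq> y" "x \<in> nodes H" "y \<in> nodes H"
  using multigraph.no_loops[OF assms(1,2)] multigraph.ends_in_nodes[OF assms(1,2)] assms(3)
  by (auto split: if_splits)

lemma multigraph_edges_update:
  "multigraph H \<Longrightarrow> X \<subseteq> edges H \<Longrightarrow> multigraph (H\<lparr>edges := X\<rparr>)"
  unfolding multigraph_def by (auto intro: finite_subset)

text \<open>Connectivity by an edge set \<open>X\<close>, with the incidence function as a separate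
  argument, so that deleting an edge or passing to a subtree changes only \<open>X\<close>. No
  vertex set is involved; the relation is reflexive everywhere.\<close>

definition joined :: "('e \<Rightarrow> 'v set) \<Rightarrow> 'e set \<Rightarrow> ('v \<times> 'v) set" where
  "joined i X = {(x, y). \<exists>e\<in>X. i e = {x, y}}\<^sup>*"

lemma joined_refl [simp]: "(x, x) \<in> joined i X"
  by (simp add: joined_def)

lemma joined_step: "(x, y) \<in> joined i X \<Longrightarrow> e \<in> X \<Longrightarrow> i e = {y, z} \<Longrightarrow> (x, z) \<in> joined i X"
  unfolding joined_def by (rule rtrancl_into_rtrancl) auto

lemma joined_edge: "e \<in> X \<Longrightarrow> i e = {x, y} \<Longrightarrow> (x, y) \<in> joined i X"
  by (rule joined_step[OF joined_refl])

lemma joined_trans: "(x, y) \<in> joined i X \<Longrightarrow> (y, z) \<in> joined i X \<Longrightarrow> (x, z) \<in> joined i X"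
  unfolding joined_def by (rule rtrancl_trans)

lemma joined_induct [consumes 1, case_names refl step]:
  assumes "(x, y) \<in> joined i X" "P x"
    and "\<And>y z e. (x, y) \<in> joined i X \<Longrightarrow> P y \<Longrightarrow> e \<in> X \<Longrightarrow> i e = {y, z} \<Longrightarrow> P z"
  shows "P y"
  using assms(1) unfolding joined_def
  by (induction rule: rtrancl_induct) (use assms(2,3) in \<open>auto simp: joined_def\<close>)

lemma joined_sym: "(x, y) \<in> joined i X \<Longrightarrow> (y, x) \<in> joined i X"
proof (induction rule: joined_induct)
  case (step y z e)
  then have "(z, y) \<in> joined i X" by (auto intro: joined_edge simp: insert_commute)
  with step.IH show ?case by (rule joined_trans[rotated])
qed simp

lemma joined_mono: "(x, y) \<in> joined i X \<Longrightarrow> X \<subseteq> Y \<Longrightarrow> (x, y) \<in> joined i Y"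
  by (induction rule: joined_induct) (auto intro: joined_step)

lemma joined_closed:
  assumes "(x, y) \<in> joined i X" "x \<in> S"
    and "\<And>e a b. e \<in> X \<Longrightarrow> i e = {a, b} \<Longrightarrow> a \<in> S \<Longrightarrow> b \<in> S"
  shows "y \<in> S"
  using assms(1) by (induction rule: joined_induct) (use assms(2,3) in auto)

lemma joined_exit:
  assumes "(x, y) \<in> joined i X" "x \<in> S" "y \<notin> S"
  obtains e a b where "e \<in> X" "i e = {a, b}" "a \<in> S" "b \<notin> S"
  using joined_closed[OF assms(1,2)] assms(3) by blast

section \<open>Walks and directed cycles in the digraph of darts\<close>

lemma dart_digraph_simps [simp]:
  "verts (dart_digraph H) = nodes H"
  "tail (dart_digraph H) d = fst d"
  "head (dart_digraph H) d = snd (snd d)"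
  "(x, e, y) \<in> arcs (dart_digraph H) \<longleftrightarrow> e \<in> edges H \<and> ends H e = {x, y}"
  by (auto simp: dart_digraph_def split: prod.splits)

lemma wf_dart_digraph: "multigraph H \<Longrightarrow> wf_digraph (dart_digraph H)"
  by unfold_locales (auto simp: multigraph_def)

lemma reachable_dart_digraph:
  assumes "multigraph H"
  shows "x \<rightarrow>\<^sup>*\<^bsub>dart_digraph H\<^esub> y \<longleftrightarrow> x \<in> nodes H \<and> (x, y) \<in> joined (ends H) (edges H)"
proof -
  interpret wf_digraph "dart_digraph H" by (rule wf_dart_digraph[OF assms])
  show ?thesis
  proof
    assume *: "x \<rightarrow>\<^sup>*\<^bsub>dart_digraph H\<^esub> y"
    then have "(x, y) \<in> joined (ends H) (edges H)"
    proof (induction rule: reachable_induct)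
      case (step y z)
      then show ?case by (auto simp: arcs_ends_def arc_to_ends_def intro: joined_step)
    qed simp
    with * show "x \<in> nodes H \<and> (x, y) \<in> joined (ends H) (edges H)"
      using reachable_in_verts by auto
  next
    assume *: "x \<in> nodes H \<and> (x, y) \<in> joined (ends H) (edges H)"
    then have "(x, y) \<in> joined (ends H) (edges H)" by simp
    then show "x \<rightarrow>\<^sup>*\<^bsub>dart_digraph H\<^esub> y"
    proof (induction rule: joined_induct)
      case refl then show ?case using * by simp
    next
      case (step y z e)
      have "(y, z) \<in> arcs_ends (dart_digraph H)"
        unfolding arcs_ends_def arc_to_ends_def
        by (rule image_eqI[of _ _ "(y, e, z)"]) (use step in auto)
      with step show ?case using reachable_adj_trans by blast
    qed
  qed
qed

lemma connected_graph_iff: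
  assumes "multigraph H"
  shows "connected_graph H \<longleftrightarrow>
    nodes H \<noteq> {} \<and> (\<forall>x\<in>nodes H. \<forall>y\<in>nodes H. (x, y) \<in> joined (ends H) (edges H))"
  unfolding connected_graph_def strongly_connected_def
  by (simp add: reachable_dart_digraph[OF assms])

lemma cas_closed:
  assumes "pre_digraph.cas D u p v" "u \<in> A"
    and "\<And>d. d \<in> set p \<Longrightarrow> tail D d \<in> A \<Longrightarrow> head D d \<in> A"
  shows "v \<in> A"
  using assms by (induction p arbitrary: u) (auto simp: pre_digraph.cas.simps)

text \<open>If no dart of the closed walk entered \<open>A\<close>, the complement of
  \<open>A\<close> would be closed along the walk: after \<open>d\<close> it would stay outside up
  to the starting point, and from there up to the tail of \<open>d\<close>, which lies in
  \<open>A\<close>.\<close>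

lemma directed_cycle_enters:
  assumes "directed_cycle H p" "d \<in> set p" "fst d \<in> A" "snd (snd d) \<notin> A"
  obtains d' where "d' \<in> set p" "fst d' \<notin> A" "snd (snd d') \<in> A"
proof (rule ccontr)
  assume "\<not> thesis"
  with that have closed: "\<And>d'. d' \<in> set p \<Longrightarrow> fst d' \<in> - A \<Longrightarrow> snd (snd d') \<in> - A" by blast
  obtain u where u: "pre_digraph.cas (dart_digraph H) u p u"
    using assms(1) by (auto simp: directed_cycle_def pre_digraph.cycle_def pre_digraph.awalk_def)
  obtain q r where p: "p = q @ d # r" using assms(2) by (meson split_list)
  have q: "pre_digraph.cas (dart_digraph H) u q (fst d)"
    and r: "pre_digraph.cas (dart_digraph H) (snd (snd d)) r u"
    using u unfolding p by (simp_all add: pre_digraph.cas_append_iff pre_digraph.cas.simps)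
  have "u \<in> - A" by (rule cas_closed[OF r]) (use assms(4) closed p in auto)
  then have "fst d \<in> - A" by (rule cas_closed[OF q]) (use closed p in auto)
  with assms(3) show False by simp
qed

lemma directed_cycle_leaves:
  assumes "directed_cycle H p" "d \<in> set p" "fst d \<notin> A" "snd (snd d) \<in> A"
  obtains d' where "d' \<in> set p" "fst d' \<in> A" "snd (snd d') \<notin> A"
  using directed_cycle_enters[of H p d "- A"] assms by auto

lemma directed_cycle_dart:
  "directed_cycle H p \<Longrightarrow> (x, e, y) \<in> set p \<Longrightarrow> e \<in> edges H \<and> ends H e = {x, y}"
  using dart_digraph_simps(4)
  by (auto simp: directed_cycle_def pre_digraph.cycle_def pre_digraph.awalk_def)

lemma directed_cycle_dart_unique:
  "directed_cycle H p \<Longrightarrow> (x, e, y) \<in> set p \<Longrightarrow> (x', e, y') \<in> set p \<Longrightarrow> x = x' \<and> y = y'"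
  unfolding directed_cycle_def distinct_map inj_on_def by fastforce

lemma directed_cycle_nonempty: "directed_cycle H p \<Longrightarrow> p \<noteq> []"
  by (auto simp: directed_cycle_def pre_digraph.cycle_def)

lemma awalk_verts_dart_digraph:
  "pre_digraph.awalk_verts (dart_digraph H) = pre_digraph.awalk_verts (dart_digraph H')"
proof (intro ext)
  fix u :: 'a and p :: "('a, 'b) dart list"
  show "pre_digraph.awalk_verts (dart_digraph H) u p = pre_digraph.awalk_verts (dart_digraph H') u p"
    by (induction p arbitrary: u) (auto simp: pre_digraph.awalk_verts.simps)
qed

lemma cas_dart_digraph:
  "pre_digraph.cas (dart_digraph H) u p v = pre_digraph.cas (dart_digraph H') u p v"
  by (induction p arbitrary: u) (auto simp: pre_digraph.cas.simps)

text \<open>Tails and heads of darts do not depend on the graph, so a walk sees the graph only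
  through its set of arcs and its starting vertex. This moves cycles between a tree, the forest
  \<open>F\<close>, an induced subgraph and the whole graph.\<close>

lemma directed_cycle_transfer:
  assumes "directed_cycle H p"
    and "\<And>x e y. (x, e, y) \<in> set p \<Longrightarrow> x \<in> nodes H' \<and> e \<in> edges H' \<and> ends H' e = ends H e"
  shows "directed_cycle H' p"
proof -
  obtain u where u: "pre_digraph.awalk (dart_digraph H) u p u"
    "distinct (tl (pre_digraph.awalk_verts (dart_digraph H) u p))" "p \<noteq> []"
    using assms(1) by (auto simp: directed_cycle_def pre_digraph.cycle_def)
  obtain d q where p: "p = d # q" using u(3) by (cases p) auto
  have cas: "pre_digraph.cas (dart_digraph H') u p u"
    using u(1) cas_dart_digraph[of H u p u H'] by (simp add: pre_digraph.awalk_def)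
  then have "fst d = u" unfolding p by (simp add: pre_digraph.cas.simps)
  then have "u \<in> nodes H'" using assms(2)[of u "fst (snd d)" "snd (snd d)"] p by auto
  moreover have "set p \<subseteq> arcs (dart_digraph H')"
    using assms(2) directed_cycle_dart[OF assms(1)] by auto
  ultimately have "pre_digraph.awalk (dart_digraph H') u p u"
    using cas by (simp add: pre_digraph.awalk_def)
  moreover have "distinct (map dart_edge p)" using assms(1) by (simp add: directed_cycle_def)
  ultimately show ?thesis
    using u(2,3) unfolding directed_cycle_def pre_digraph.cycle_def
    by (metis awalk_verts_dart_digraph)
qed

text \<open>An edge of the path that reappears later, in whichever direction, has \<open>a\<close>
  among its ends, so the rest of the path would visit \<open>a\<close> a second time.\<close>

lemma apath_distinct_edges:
  assumes "multigraph H" "pre_digraph.apath (dart_digraph H) x p y"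
  shows "distinct (map dart_edge p)"
proof -
  interpret wf_digraph "dart_digraph H" by (rule wf_dart_digraph[OF assms(1)])
  show ?thesis using assms(2)
  proof (induction p arbitrary: x)
    case (Cons d p)
    obtain a e b where d: "d = (a, e, b)" by (cases d)
    have p: "apath b p y" "a \<notin> set (awalk_verts b p)" "ends H e = {a, b}"
      using Cons.prems unfolding d by (auto simp: apath_Cons_iff)
    have "e \<notin> dart_edge ` set p"
    proof
      assume "e \<in> dart_edge ` set p"
      then obtain c c' where c: "(c, e, c') \<in> set p" by force
      have w: "awalk b p y" using p(1) by (simp add: apath_def)
      then have "ends H e = {c, c'}" using c dart_digraph_simps(4)[of c e c' H]
        by (auto simp: awalk_def)
      then have "a = c \<or> a = c'" using p(3) by auto
      moreover have "c \<in> set (awalk_verts b p)" "c' \<in> set (awalk_verts b p)"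
        using awalk_verts_arc1[OF c, of b] awalk_verts_arc2[OF w c] by auto
      ultimately show False using p(2) by auto
    qed
    then show ?case using Cons.IH[OF p(1)] d by auto
  qed simp
qed

text \<open>A simple path from \<open>x\<close> to \<open>y\<close> inside \<open>X\<close> is
  closed up by the dart \<open>(y, f, x)\<close>; \<open>f \<notin> X\<close> keeps the edges
  distinct. Swapping \<open>x\<close> and \<open>y\<close> gives a cycle with the other direction of
  \<open>f\<close>.\<close>

lemma directed_cycle_exists:
  assumes "multigraph H" "f \<in> edges H" "X \<subseteq> edges H" "f \<notin> X"
    and "ends H f = {x, y}" "(x, y) \<in> joined (ends H) X"
  obtains p where "directed_cycle (H\<lparr>edges := insert f X\<rparr>) p" "(y, f, x) \<in> set p"
proof -
  let ?H = "H\<lparr>edges := X\<rparr>" and ?H' = "H\<lparr>edges := insert f X\<rparr>"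
  have mg: "multigraph ?H" "multigraph ?H'"
    using assms(1-3) by (auto intro: multigraph_edges_update)
  interpret h: wf_digraph "dart_digraph ?H" by (rule wf_dart_digraph[OF mg(1)])
  interpret h': wf_digraph "dart_digraph ?H'" by (rule wf_dart_digraph[OF mg(2)])
  have nodes: "x \<in> nodes H" "y \<in> nodes H" using multigraph_ends_neq[OF assms(1,2,5)] by auto
  have "x \<rightarrow>\<^sup>*\<^bsub>dart_digraph ?H\<^esub> y" using reachable_dart_digraph[OF mg(1)] assms(6) nodes by simp
  then obtain p0 where "h.awalk x p0 y" using h.reachable_awalk by auto
  then obtain p where p: "h.apath x p y" using h.apath_awalk_to_apath by blast
  have w: "h.awalk x p y" "distinct (h.awalk_verts x p)" using p by (auto simp: h.apath_def)
  have pX: "dart_edge ` set p \<subseteq> X" using w(1) dart_digraph_simps(4)[of _ _ _ ?H]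
    by (auto simp: h.awalk_def)
  let ?p = "p @ [(y, f, x)]"
  have w': "h'.awalk x p y"
    using w(1) cas_dart_digraph[of ?H x p y ?H'] dart_digraph_simps(4)[of _ _ _ ?H]
    by (auto simp: h.awalk_def h'.awalk_def)
  have "h'.awalk y [(y, f, x)] x"
    using nodes assms(2,5) by (auto simp: h'.awalk_simps insert_commute)
  with w' have "h'.awalk x ?p x" by auto
  moreover have "h'.awalk_verts x ?p = h'.awalk_verts x p @ [x]"
    using h'.awalk_verts_append[OF \<open>h'.awalk x ?p x\<close>] w' by (simp add: h'.awalk_verts.simps)
  moreover have *: "h'.awalk_verts x p = x # tl (h'.awalk_verts x p)"
    using w' by (cases p) (auto simp: h'.awalk_simps)
  moreover have "x \<notin> set (tl (h'.awalk_verts x p))" "distinct (tl (h'.awalk_verts x p))"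
    using w(2) * awalk_verts_dart_digraph[of ?H ?H'] by (metis distinct.simps(2))+
  moreover have "tl (h'.awalk_verts x p @ [x]) = tl (h'.awalk_verts x p) @ [x]"
    by (rule tl_append2) (use * in \<open>metis list.distinct(1)\<close>)
  ultimately have "h'.cycle ?p" unfolding h'.cycle_def
    by (intro exI[of _ x]) simp
  moreover have "distinct (map dart_edge ?p)"
    using apath_distinct_edges[OF mg(1) p] pX assms(4) by auto
  ultimately have "directed_cycle (H\<lparr>edges := insert f X\<rparr>) ?p" unfolding directed_cycle_def by blast
  then show ?thesis by (rule that) simp
qed

text \<open>Every edge of the cycle would do. If \<open>b\<close> were not joined to
  \<open>a\<close> without \<open>e\<close>, the cycle would leave the component of \<open>a\<close>
  along \<open>e\<close>; it has to re-enter it, no edge other than \<open>e\<close> crosses the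
  boundary, and \<open>e\<close> is traversed only once.\<close>

lemma directed_cycle_meets_nonbridge:
  assumes "directed_cycle H p"
  obtains a e b where "(a, e, b) \<in> set p" "(a, b) \<in> joined (ends H) (edges H - {e})"
proof -
  obtain a e b where d: "(a, e, b) \<in> set p"
    using directed_cycle_nonempty[OF assms] by (metis list.set_intros(1) neq_Nil_conv prod_cases3)
  have "(a, b) \<in> joined (ends H) (edges H - {e})"
  proof (rule ccontr)
    let ?A = "{x. (a, x) \<in> joined (ends H) (edges H - {e})}"
    assume "(a, b) \<notin> joined (ends H) (edges H - {e})"
    then obtain d' where d': "d' \<in> set p" "fst d' \<notin> ?A" "snd (snd d') \<in> ?A"
      using directed_cycle_enters[OF assms d, of ?A] by auto
    obtain x f y where xy: "d' = (x, f, y)" by (cases d')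
    have f: "f \<in> edges H" "ends H f = {y, x}"
      using directed_cycle_dart[OF assms] d' xy by auto
    have "f = e" using joined_step[of a y "ends H" "edges H - {e}" f x] f d' xy by auto
    then show False using directed_cycle_dart_unique[OF assms d] d' xy by auto
  qed
  with d that show ?thesis by blast
qed

text \<open>Acyclicity expressed by connectivity alone: every edge of \<open>T\<close> is a bridge
  of \<open>T\<close>. In this form it passes through the attachment of leaves and through cuts
  without any mention of walks.\<close>

definition bridges :: "('e \<Rightarrow> 'v set) \<Rightarrow> 'e set \<Rightarrow> bool" where
  "bridges i T \<longleftrightarrow> (\<forall>e\<in>T. \<forall>x y. i e = {x, y} \<longrightarrow> (x, y) \<notin> joined i (T - {e}))"

lemma forest_of_iff:
  assumes "multigraph H"
  shows "forest_of H T \<longleftrightarrow> T \<subseteq> edges H \<and> bridges (ends H) T"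
proof
  assume f: "forest_of H T"
  then have T: "T \<subseteq> edges H" by (simp add: forest_of_def)
  have "bridges (ends H) T" unfolding bridges_def
  proof (intro ballI allI impI notI)
    fix e x y assume e: "e \<in> T" "ends H e = {x, y}" "(x, y) \<in> joined (ends H) (T - {e})"
    obtain p where "directed_cycle (H\<lparr>edges := insert e (T - {e})\<rparr>) p"
      by (rule directed_cycle_exists[OF assms _ _ _ e(2,3)]) (use e T in auto)
    then show False using f e(1) by (auto simp: forest_of_def insert_absorb)
  qed
  with T show "T \<subseteq> edges H \<and> bridges (ends H) T" by simp
next
  assume T: "T \<subseteq> edges H \<and> bridges (ends H) T"
  have "\<not> directed_cycle (H\<lparr>edges := T\<rparr>) p" for p
  proof
    assume p: "directed_cycle (H\<lparr>edges := T\<rparr>) p"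
    then obtain a e b where "(a, e, b) \<in> set p" "(a, b) \<in> joined (ends H) (T - {e})"
      by (rule directed_cycle_meets_nonbridge) auto
    then show False using directed_cycle_dart[OF p] T unfolding bridges_def by fastforce
  qed
  with T show "forest_of H T" by (auto simp: forest_of_def)
qed

lemma spanning_tree_of_iff:
  assumes "multigraph H"
  shows "spanning_tree_of H T \<longleftrightarrow> nodes H \<noteq> {} \<and> T \<subseteq> edges H \<and>
    (\<forall>x\<in>nodes H. \<forall>y\<in>nodes H. (x, y) \<in> joined (ends H) T) \<and> bridges (ends H) T"
proof (cases "T \<subseteq> edges H")
  case True
  then show ?thesis
    using connected_graph_iff[OF multigraph_edges_update[OF assms True]]
    by (auto simp: spanning_tree_of_def forest_of_iff[OF assms])
qed (auto simp: spanning_tree_of_def forest_of_def)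

section \<open>Arborescences and orientations\<close>

text \<open>Growth by one leaf at a time, with darts pointing away from the root \<open>q\<close>;
  \<open>S\<close> is the set of vertices reached so far. Acyclicity and the count of heads then
  come by induction.\<close>

inductive arborescence ::
    "('e \<Rightarrow> 'v set) \<Rightarrow> 'v \<Rightarrow> 'v set \<Rightarrow> ('v, 'e) dart set \<Rightarrow> bool" for i q where
  root: "arborescence i q {q} {}"
| grow: "arborescence i q S P \<Longrightarrow> a \<in> S \<Longrightarrow> b \<notin> S \<Longrightarrow> i e = {a, b} \<Longrightarrow>
    arborescence i q (insert b S) (insert (a, e, b) P)"

lemma arborescence_dart:
  assumes "arborescence i q S P" "(a, e, b) \<in> P"
  shows "i e = {a, b}" "a \<in> S" "b \<in> S" "a \<noteq> b" "b \<noteq> q"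
proof -
  have "q \<in> S \<and> (\<forall>(a, e, b) \<in> P. i e = {a, b} \<and> a \<in> S \<and> b \<in> S \<and> a \<noteq> b \<and> b \<noteq> q)"
    using assms(1) by induction auto
  with assms(2) show "i e = {a, b}" "a \<in> S" "b \<in> S" "a \<noteq> b" "b \<noteq> q" by auto
qed

lemma arborescence_root: "arborescence i q S P \<Longrightarrow> q \<in> S"
  by (induction rule: arborescence.induct) auto

lemma arborescence_finite: "arborescence i q S P \<Longrightarrow> finite P"
  by (induction rule: arborescence.induct) auto

text \<open>Induction from the root along the darts: \<open>W\<close> plays the role of a property
  of vertices that darts pass on from tail to head.\<close>

lemma arborescence_closed:
  assumes "arborescence i q S P" "q \<in> W"
    and "\<And>a e b. (a, e, b) \<in> P \<Longrightarrow> a \<in> W \<Longrightarrow> b \<in> W"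
  shows "S \<subseteq> W"
  using assms(1,3)
proof (induction rule: arborescence.induct)
  case root
  then show ?case using assms(2) by simp
next
  case (grow S P a b e)
  have "S \<subseteq> W" by (rule grow.IH) (rule grow.prems[OF insertI2])
  moreover from this have "b \<in> W" by (intro grow.prems[of a e b]) (use grow.hyps in auto)
  ultimately show ?case by simp
qed

lemma arborescence_joined:
  assumes "arborescence i q S P" "x \<in> S" "y \<in> S"
  shows "(x, y) \<in> joined i (dart_edge ` P)"
proof -
  let ?J = "joined i (dart_edge ` P)"
  have "S \<subseteq> {x. (q, x) \<in> ?J}"
  proof (rule arborescence_closed[OF assms(1)])
    fix a e b assume "(a, e, b) \<in> P" "a \<in> {x. (q, x) \<in> ?J}"
    then show "b \<in> {x. (q, x) \<in> ?J}"
      using arborescence_dart(1)[OF assms(1)]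
      by (auto intro!: joined_step[of q a i "dart_edge ` P" e b] image_eqI[of _ _ "(a, e, b)"])
  qed simp
  then show ?thesis using assms(2,3) by (blast intro: joined_trans joined_sym)
qed

lemma arborescence_new_edge:
  assumes "arborescence i q S P" "b \<notin> S" "i e = {a, b}"
  shows "e \<notin> dart_edge ` P"
proof
  assume "e \<in> dart_edge ` P"
  then obtain x y where "(x, e, y) \<in> P" by force
  from arborescence_dart(1-3)[OF assms(1) this] assms(2,3) show False by auto
qed

lemma arborescence_inj: "arborescence i q S P \<Longrightarrow> inj_on dart_edge P"
proof (induction rule: arborescence.induct)
  case (grow S P a b e)
  then show ?case using arborescence_new_edge[OF grow.hyps(1,3,4)] by auto
qed simp

text \<open>Each vertex except the root is the head of exactly one dart. This is what cancels the
  \<open>-1\<close> at every vertex of an orientation divisor, at the root with the help of the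
  extra chip.\<close>

lemma arborescence_heads:
  "arborescence i q S P \<Longrightarrow> (\<Sum>d\<in>P. chip (snd (snd d))) + chip q = (\<Sum>x\<in>S. chip x)"
proof (induction rule: arborescence.induct)
  case (grow S P a b e)
  have "finite S" using grow.hyps(1) by induction auto
  moreover have "(a, e, b) \<notin> P" using arborescence_dart(3)[OF grow.hyps(1)] grow.hyps by blast
  ultimately have "(\<Sum>d\<in>insert (a, e, b) P. chip (snd (snd d))) + chip q =
      chip b + ((\<Sum>d\<in>P. chip (snd (snd d))) + chip q)"
    and "(\<Sum>x\<in>insert b S. chip x) = chip b + (\<Sum>x\<in>S. chip x)"
    using grow.hyps(3) arborescence_finite[OF grow.hyps(1)] by (simp_all only: sum.insert add.assoc snd_conv not_False_eq_True simp_thms)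
  then show ?case by (simp only: grow.IH)
qed simp

text \<open>\<open>e\<close> is the only edge at \<open>b\<close>, so a walk that steps to
  \<open>b\<close> can only step back to \<open>a\<close>, and the detour through the leaf can be
  cut out.\<close>

lemma joined_leaf:
  assumes "(x, z) \<in> joined i (insert e X)" "i e = {a, b}"
    and "\<And>f. f \<in> X \<Longrightarrow> b \<notin> i f" "x \<noteq> b" "z \<noteq> b"
  shows "(x, z) \<in> joined i X"
proof -
  \<comment> \<open>While the walk sits at the leaf, the invariant remembers its neighbour
    \<open>a\<close> instead.\<close>
  have "if z = b then (x, a) \<in> joined i X else (x, z) \<in> joined i X"
    using assms(1)
  proof (induction rule: joined_induct)
    case refl
    show ?case using assms(4) by simp
  next
    case (step y z f)
    show ?case
    proof (cases "f = e")
      case True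
      with step.hyps(3) assms(2) have "y = a \<and> z = b \<or> y = b \<and> z = a" by (auto simp: doubleton_eq_iff)
      with step.IH show ?thesis by (auto split: if_splits)
    next
      case False
      then have f: "f \<in> X" using step.hyps(2) by simp
      then have "b \<notin> {y, z}" using assms(3)[OF f] step.hyps(3) by simp
      then have "y \<noteq> b" "z \<noteq> b" by auto
      then show ?thesis using step.IH joined_step[of x y i X f z, OF _ f step.hyps(3)] by simp
    qed
  qed
  with assms(5) show ?thesis by simp
qed

text \<open>Deleting the last edge \<open>e\<close> separates its leaf \<open>b\<close>, because
  older edges stay inside \<open>S\<close>. For an older edge the leaf offers no way around, by
  \<open>joined_leaf\<close>, so the induction hypothesis applies.\<close>

lemma arborescence_bridges: "arborescence i q S P \<Longrightarrow> bridges i (dart_edge ` P)"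
proof (induction rule: arborescence.induct)
  case root
  then show ?case by (simp add: bridges_def)
next
  case (grow S P a b e)
  let ?T = "dart_edge ` P"
  have e: "e \<notin> ?T" by (rule arborescence_new_edge[OF grow.hyps(1,3,4)])
  have ends: "i f \<subseteq> S" if "f \<in> ?T" for f
    using that arborescence_dart[OF grow.hyps(1)] by fastforce
  have closed: "z \<in> S" if "(y, z) \<in> joined i ?T" "y \<in> S" for y z
    by (rule joined_closed[OF that]) (use ends in blast)
  show ?case unfolding bridges_def
  proof (intro ballI allI impI notI)
    fix f x y assume f: "f \<in> dart_edge ` insert (a, e, b) P" "i f = {x, y}"
      and xy: "(x, y) \<in> joined i (dart_edge ` insert (a, e, b) P - {f})"
    show False
    proof (cases "f = e")
      case True
      then have "(x, y) \<in> joined i ?T" using xy e by simp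
      moreover have "x = a \<and> y = b \<or> x = b \<and> y = a"
        using f(2) True grow.hyps by (auto simp: doubleton_eq_iff)
      ultimately have "(a, b) \<in> joined i ?T" by (auto intro: joined_sym)
      then show False using closed grow.hyps by blast
    next
      case False
      then have T: "f \<in> ?T" using f by auto
      then have "x \<in> S" "y \<in> S" using ends f(2) by auto
      moreover have "(x, y) \<in> joined i (insert e (?T - {f}))"
        using xy False by (simp add: insert_Diff_if)
      ultimately have xy': "(x, y) \<in> joined i (insert e (?T - {f}))" "x \<noteq> b" "y \<noteq> b"
        using grow.hyps(3) by auto
      have nb: "b \<notin> i g" if "g \<in> ?T - {f}" for g
        using ends[of g] that grow.hyps(3) by blast
      have "(x, y) \<in> joined i (?T - {f})"
        by (rule joined_leaf[OF xy'(1) grow.hyps(4) nb xy'(2,3)])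
      then show False using grow.IH T f(2) by (auto simp: bridges_def)
    qed
  qed
qed

lemma arborescence_exists:
  assumes "finite V" "q \<in> V"
    and "\<And>S. q \<in> S \<Longrightarrow> S \<subset> V \<Longrightarrow>
      \<exists>a e b. (a, e, b) \<in> X \<and> a \<in> S \<and> b \<in> V - S \<and> i e = {a, b}"
  obtains P where "P \<subseteq> X" "arborescence i q V P"
proof -
  have "\<exists>P. P \<subseteq> X \<and> arborescence i q V P"
    if "arborescence i q S P0" "P0 \<subseteq> X" "S \<subseteq> V" for S P0
    using that
  proof (induction "card (V - S)" arbitrary: S P0 rule: less_induct)
    case less
    show ?case
    proof (cases "S = V")
      case True
      then show ?thesis using less by blast
    next
      case False
      then obtain a e b where e: "(a, e, b) \<in> X" "a \<in> S" "b \<in> V - S" "i e = {a, b}"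
        using assms(3)[of S] arborescence_root[OF less.prems(1)] less.prems(3) by blast
      show ?thesis
      proof (rule less.hyps)
        show "arborescence i q (insert b S) (insert (a, e, b) P0)"
          using less.prems e by (intro arborescence.grow) auto
        show "card (V - insert b S) < card (V - S)"
          using assms(1) e by (intro psubset_card_mono) auto
      qed (use less.prems e in auto)
    qed
  qed
  from this[OF arborescence.root] assms(2) that show ?thesis by auto
qed

lemma arborescence_spanning_tree:
  assumes "multigraph H" "arborescence (ends H) q (nodes H) P" "dart_edge ` P \<subseteq> edges H"
  shows "spanning_tree_of H (dart_edge ` P)"
  using assms arborescence_root[OF assms(2)] arborescence_joined[OF assms(2)]
    arborescence_bridges[OF assms(2)]
  by (auto simp: spanning_tree_of_iff)

lemma spanning_tree_arborescence:
  assumes "multigraph H" "spanning_tree_of H T" "q \<in> nodes H"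
  obtains P where "arborescence (ends H) q (nodes H) P" "dart_edge ` P = T"
proof -
  note T = assms(2)[unfolded spanning_tree_of_iff[OF assms(1)]]
  obtain P where P: "P \<subseteq> {(a, e, b). e \<in> T}" "arborescence (ends H) q (nodes H) P"
  proof (rule arborescence_exists[of "nodes H" q "{(a, e, b). e \<in> T}" "ends H"])
    fix S assume S: "q \<in> S" "S \<subset> nodes H"
    then obtain x where x: "x \<in> nodes H" "x \<notin> S" by blast
    then have "(q, x) \<in> joined (ends H) T" using T assms(3) by blast
    then obtain e a b where e: "e \<in> T" "ends H e = {a, b}" "a \<in> S" "b \<notin> S"
      by (rule joined_exit[OF _ S(1) x(2)])
    then have "b \<in> nodes H" using multigraph_ends_neq(3)[OF assms(1) _ e(2)] T by blast
    with e show "\<exists>a e b. (a, e, b) \<in> {(a, e, b). e \<in> T} \<and> a \<in> S \<and> b \<in> nodes H - S \<and>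
        ends H e = {a, b}" by auto
  qed (use assms multigraph.finite_nodes in auto)
  have "e \<in> dart_edge ` P" if "e \<in> T" for e
  proof (rule ccontr)
    assume e: "e \<notin> dart_edge ` P"
    have "e \<in> edges H" using T \<open>e \<in> T\<close> by blast
    then obtain x y where xy: "ends H e = {x, y}" "x \<in> nodes H" "y \<in> nodes H"
      by (rule multigraph_ends[OF assms(1)])
    have "(x, y) \<in> joined (ends H) (T - {e})"
      by (rule joined_mono[OF arborescence_joined[OF P(2) xy(2,3)]]) (use e P(1) in auto)
    then show False using T \<open>e \<in> T\<close> xy(1) by (auto simp: bridges_def)
  qed
  then have "dart_edge ` P = T" using P(1) by auto
  with P(2) that show ?thesis by blast
qed

section \<open>Reachability in an orientation\<close>

lemma orientation_arc:
  "orientation_of H \<O> \<Longrightarrow> e \<in> edges H \<Longrightarrow> ends H e = {tail \<O> e, head \<O> e}"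
  by (simp add: orientation_of_def)

lemma orientation_wf:
  assumes "multigraph H" "orientation_of H \<O>"
  shows "wf_digraph \<O>"
  using assms by unfold_locales (auto simp: multigraph_def orientation_of_def)

lemma reachable_arc:
  assumes "multigraph H" "orientation_of H \<O>" "u \<rightarrow>\<^sup>*\<^bsub>\<O>\<^esub> tail \<O> e" "e \<in> edges H"
  shows "u \<rightarrow>\<^sup>*\<^bsub>\<O>\<^esub> head \<O> e"
proof -
  interpret wf_digraph \<O> by (rule orientation_wf[OF assms(1,2)])
  have "(tail \<O> e, head \<O> e) \<in> arcs_ends \<O>"
    using assms(2,4) by (auto simp: arcs_ends_def arc_to_ends_def orientation_of_def)
  with assms(3) show ?thesis using reachable_adj_trans by blast
qed

lemma reachable_closed:
  assumes "multigraph H" "orientation_of H \<O>" "u \<rightarrow>\<^sup>*\<^bsub>\<O>\<^esub> x" "u \<in> S"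
    and "\<And>e. e \<in> edges H \<Longrightarrow> tail \<O> e \<in> S \<Longrightarrow> head \<O> e \<in> S"
  shows "x \<in> S"
proof -
  interpret wf_digraph \<O> by (rule orientation_wf[OF assms(1,2)])
  show ?thesis using assms(3)
    by (induction rule: reachable_induct)
      (use assms(2,4,5) in \<open>auto simp: arcs_ends_def arc_to_ends_def orientation_of_def\<close>)
qed

lemma reachable_orientation_refl: "orientation_of H \<O> \<Longrightarrow> u \<in> nodes H \<Longrightarrow> u \<rightarrow>\<^sup>*\<^bsub>\<O>\<^esub> u"
  by (simp add: reachable_def orientation_of_def)

lemma reachable_set_subset:
  assumes "multigraph H" "orientation_of H \<O>"
  shows "reachable_set \<O> u \<subseteq> nodes H"
proof -
  interpret wf_digraph \<O> by (rule orientation_wf[OF assms])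
  show ?thesis
    using assms(2) reachable_in_verts(2) by (auto simp: reachable_set_def orientation_of_def)
qed

lemma reachable_set_closed:
  assumes "multigraph H" "orientation_of H \<O>" "e \<in> edges H" "tail \<O> e \<in> reachable_set \<O> u"
  shows "head \<O> e \<in> reachable_set \<O> u"
  using assms reachable_arc by (fastforce simp: reachable_set_def)

section \<open>Orientation divisors as sums of chips, and break divisors\<close>

lemma sum_divisor_apply: "(\<Sum>e\<in>A. D e) x = (\<Sum>e\<in>A. (D e x :: int))"
  by (induction A rule: infinite_finite_induct) auto

lemma sum_chip_apply:
  "finite A \<Longrightarrow> (\<Sum>e\<in>A. chip (h e)) x = int (card {e \<in> A. h e = x})"
proof -
  assume "finite A"
  have "(\<Sum>e\<in>A. chip (h e)) x = (\<Sum>e\<in>A. if h e = x then 1 else 0)"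
    by (auto simp: sum_divisor_apply chip_def intro: sum.cong)
  also have "\<dots> = int (card {e \<in> A. h e = x})"
    using \<open>finite A\<close> by (simp add: sum.If_cases Int_def)
  finally show ?thesis .
qed

text \<open>With the in-degrees written as one chip per arc, restrictions and deletions become
  identities between sums over edge sets.\<close>

lemma orientation_divisor_eq:
  assumes "multigraph H" "orientation_of H \<O>"
  shows "orientation_divisor \<O> =
    (\<Sum>e\<in>edges H. chip (head \<O> e)) - (\<Sum>x\<in>nodes H. chip x)"
proof
  fix x
  have fin: "finite (edges H)" "finite (nodes H)"
    using assms(1) by (auto simp: multigraph_def)
  have h: "head \<O> e \<in> nodes H" if "e \<in> edges H" for e
    using that assms by (auto simp: multigraph_def orientation_of_def)
  have "{y \<in> nodes H. y = x} = (if x \<in> nodes H then {x} else {})" by auto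
  moreover have "x \<notin> nodes H \<Longrightarrow> {e \<in> edges H. head \<O> e = x} = {}" using h by auto
  ultimately show "orientation_divisor \<O> x =
      ((\<Sum>e\<in>edges H. chip (head \<O> e)) - (\<Sum>x\<in>nodes H. chip x)) x"
    using assms(2) fin
    by (auto simp: orientation_divisor_def orientation_of_def in_degree_def in_arcs_def
        sum_chip_apply)
qed

text \<open>The arcs of an arborescence inside \<open>\<O>\<close> put one chip on every vertex but
  \<open>q\<close>. Together with the chip at \<open>q\<close> they cancel the \<open>-1\<close> of
  every vertex, and the arcs outside the tree leave exactly the chips of a break divisor.\<close>

lemma root_connected_break:
  assumes "multigraph H" "orientation_of H \<O>" "root_connected \<O> q" "q \<in> nodes H"
  shows "connected_graph H" "break_divisor H (orientation_divisor \<O> + chip q)"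
proof -
  obtain P where P: "P \<subseteq> {(tail \<O> e, e, head \<O> e) | e. e \<in> edges H}"
    "arborescence (ends H) q (nodes H) P"
  proof (rule arborescence_exists)
    fix S assume S: "q \<in> S" "S \<subset> nodes H"
    then obtain x where x: "x \<in> nodes H" "x \<notin> S" by blast
    then have "q \<rightarrow>\<^sup>*\<^bsub>\<O>\<^esub> x" using assms(2,3) by (simp add: root_connected_def orientation_of_def)
    then obtain e where e: "e \<in> edges H" "tail \<O> e \<in> S" "head \<O> e \<notin> S"
      using reachable_closed[OF assms(1,2) _ S(1)] x(2) by blast
    moreover have "ends H e = {tail \<O> e, head \<O> e}" by (rule orientation_arc[OF assms(2) e(1)])
    moreover have "head \<O> e \<in> nodes H"
      using multigraph_ends_neq(3)[OF assms(1) e(1)] calculation by blast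
    ultimately show "\<exists>a e b. (a, e, b) \<in> {(tail \<O> e, e, head \<O> e) | e. e \<in> edges H} \<and>
        a \<in> S \<and> b \<in> nodes H - S \<and> ends H e = {a, b}" by auto
  qed (use assms multigraph.finite_nodes in auto)
  let ?T = "dart_edge ` P"
  have T: "?T \<subseteq> edges H" using P(1) by auto
  have tree: "spanning_tree_of H ?T" by (rule arborescence_spanning_tree[OF assms(1) P(2) T])
  show "connected_graph H"
    using tree joined_mono[OF _ T, of _ _ "ends H"]
    by (simp add: connected_graph_iff[OF assms(1)] spanning_tree_of_iff[OF assms(1)])
  have fin: "finite (edges H)" using assms(1) by (simp add: multigraph_def)
  have "(\<Sum>e\<in>?T. chip (head \<O> e)) = (\<Sum>d\<in>P. chip (head \<O> (dart_edge d)))"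
    by (simp add: sum.reindex[OF arborescence_inj[OF P(2)]])
  also have "\<dots> = (\<Sum>d\<in>P. chip (snd (snd d)))" using P(1) by (intro sum.cong) auto
  finally have "(\<Sum>e\<in>?T. chip (head \<O> e)) + chip q = (\<Sum>x\<in>nodes H. chip x)"
    using arborescence_heads[OF P(2)] by simp
  moreover have "(\<Sum>e\<in>edges H. chip (head \<O> e)) =
      (\<Sum>e\<in>edges H - ?T. chip (head \<O> e)) + (\<Sum>e\<in>?T. chip (head \<O> e))"
    by (rule sum.subset_diff[OF T fin])
  ultimately have "orientation_divisor \<O> + chip q = (\<Sum>e\<in>edges H - ?T. chip (head \<O> e))"
    unfolding orientation_divisor_eq[OF assms(1,2)] by (simp add: algebra_simps)
  moreover have "\<forall>f\<in>edges H - ?T. head \<O> f \<in> ends H f"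
    using orientation_arc[OF assms(2)] by auto
  ultimately show "break_divisor H (orientation_divisor \<O> + chip q)"
    using tree unfolding break_divisor_def by blast
qed

text \<open>The rooted form \<open>P\<close> of the tree is exported along with \<open>\<O>\<close>:
  later arguments use that tree arcs point away from \<open>q\<close>, besides the value of the
  divisor.\<close>

lemma spanning_tree_orientation:
  assumes "multigraph H" "spanning_tree_of H T" "\<forall>f\<in>edges H - T. c f \<in> ends H f" "q \<in> nodes H"
  obtains \<O> P where "orientation_of H \<O>" "root_connected \<O> q"
    "(\<Sum>f\<in>edges H - T. chip (c f)) = orientation_divisor \<O> + chip q"
    "\<forall>f\<in>edges H - T. head \<O> f = c f"
    "arborescence (ends H) q (nodes H) P" "dart_edge ` P = T"
    "\<forall>a e b. (a, e, b) \<in> P \<longrightarrow> tail \<O> e = a \<and> head \<O> e = b"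
proof -
  obtain P where P: "arborescence (ends H) q (nodes H) P" "dart_edge ` P = T"
    by (rule spanning_tree_arborescence[OF assms(1,2,4)])
  have T: "T \<subseteq> edges H" using assms(2) by (simp add: spanning_tree_of_iff[OF assms(1)])
  \<comment> \<open>The pair \<open>d\<close> consists of tail and head, read off from the dart in
    \<open>P\<close> for a tree edge and from the chip otherwise.\<close>
  have "\<exists>d. ends H f = {fst d, snd d} \<and> (f \<notin> T \<longrightarrow> snd d = c f) \<and>
      (f \<in> T \<longrightarrow> (fst d, f, snd d) \<in> P)" if f: "f \<in> edges H" for f
  proof (cases "f \<in> T")
    case True
    then obtain a b where "(a, f, b) \<in> P" using P(2) by force
    then show ?thesis using arborescence_dart(1)[OF P(1)] True by (intro exI[of _ "(a, b)"]) auto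
  next
    case False
    then obtain a where "ends H f = {a, c f}"
      using multigraph_other_end[OF assms(1) f, of "c f"] assms(3) f by blast
    then show ?thesis using False by (intro exI[of _ "(a, c f)"]) auto
  qed
  then obtain d where d: "\<And>f. f \<in> edges H \<Longrightarrow> ends H f = {fst (d f), snd (d f)} \<and>
      (f \<notin> T \<longrightarrow> snd (d f) = c f) \<and> (f \<in> T \<longrightarrow> (fst (d f), f, snd (d f)) \<in> P)"
    by metis
  define \<O> where "\<O> = \<lparr>verts = nodes H, arcs = edges H,
    tail = (\<lambda>f. fst (d f)), head = (\<lambda>f. snd (d f))\<rparr>"
  have \<O>: "orientation_of H \<O>" using d by (auto simp: \<O>_def orientation_of_def)
  have heads: "head \<O> f = c f" if "f \<in> edges H - T" for f using that d by (simp add: \<O>_def)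
  have darts: "tail \<O> e = a \<and> head \<O> e = b" if e: "(a, e, b) \<in> P" for a e b
  proof -
    have "e \<in> T" using e P(2) by force
    then have "(fst (d e), e, snd (d e)) \<in> P" using d T by blast
    then have "(fst (d e), e, snd (d e)) = (a, e, b)"
      by (intro inj_onD[OF arborescence_inj[OF P(1)]]) (use e in simp_all)
    then show ?thesis by (simp add: \<O>_def)
  qed
  have "nodes H \<subseteq> {x. q \<rightarrow>\<^sup>*\<^bsub>\<O>\<^esub> x}"
  proof (rule arborescence_closed[OF P(1)])
    fix a e b assume e: "(a, e, b) \<in> P" "a \<in> {x. q \<rightarrow>\<^sup>*\<^bsub>\<O>\<^esub> x}"
    have "e \<in> edges H" using e(1) P(2) T by force
    then show "b \<in> {x. q \<rightarrow>\<^sup>*\<^bsub>\<O>\<^esub> x}"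
      using reachable_arc[OF assms(1) \<O>, of q e] darts[OF e(1)] e(2) by simp
  qed (use reachable_orientation_refl[OF \<O> assms(4)] in simp)
  then have root: "root_connected \<O> q" by (auto simp: root_connected_def \<O>_def)
  have fin: "finite (edges H)" using assms(1) by (simp add: multigraph_def)
  have "(\<Sum>e\<in>T. chip (head \<O> e)) = (\<Sum>e\<in>P. chip (head \<O> (dart_edge e)))"
    by (simp add: sum.reindex[OF arborescence_inj[OF P(1)]] P(2)[symmetric])
  also have "\<dots> = (\<Sum>d\<in>P. chip (snd (snd d)))" using darts by (intro sum.cong) auto
  finally have "(\<Sum>e\<in>T. chip (head \<O> e)) + chip q = (\<Sum>x\<in>nodes H. chip x)"
    using arborescence_heads[OF P(1)] by simp
  moreover have "(\<Sum>e\<in>edges H. chip (head \<O> e)) =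
      (\<Sum>e\<in>edges H - T. chip (head \<O> e)) + (\<Sum>e\<in>T. chip (head \<O> e))"
    by (rule sum.subset_diff[OF T fin])
  moreover have "(\<Sum>e\<in>edges H - T. chip (head \<O> e)) = (\<Sum>e\<in>edges H - T. chip (c e))"
    using heads by (intro sum.cong) auto
  ultimately have "(\<Sum>f\<in>edges H - T. chip (c f)) = orientation_divisor \<O> + chip q"
    unfolding orientation_divisor_eq[OF assms(1) \<O>] by (simp add: algebra_simps)
  then show ?thesis using that \<O> root heads P darts by blast
qed

lemma card_heads:
  assumes "multigraph H" "orientation_of H \<O>"
  shows "int (card {e \<in> edges H. head \<O> e \<in> R}) =
    (\<Sum>x\<in>nodes H \<inter> R. (\<Sum>e\<in>edges H. chip (head \<O> e)) x)"
proof -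
  have fin: "finite (edges H)" "finite (nodes H)"
    using assms(1) by (auto simp: multigraph_def)
  have h: "head \<O> e \<in> nodes H" if "e \<in> edges H" for e
    using that assms by (auto simp: multigraph_def orientation_of_def)
  have "(\<Sum>x\<in>nodes H \<inter> R. \<Sum>e\<in>{e \<in> {e \<in> edges H. head \<O> e \<in> R}. head \<O> e = x}. 1::int) =
      (\<Sum>e\<in>{e \<in> edges H. head \<O> e \<in> R}. 1)"
    by (rule sum.group) (use fin h in auto)
  moreover have "{e \<in> {e \<in> edges H. head \<O> e \<in> R}. head \<O> e = x} = {e \<in> edges H. head \<O> e = x}"
    if "x \<in> nodes H \<inter> R" for x using that by auto
  ultimately show ?thesis using fin by (simp add: sum_chip_apply)
qed

text \<open>
  The number of arcs with head in \<open>R\<close> depends on the divisor only, and it is minimal, namely the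
  number of edges inside \<open>R\<close>, exactly when no arc enters \<open>R\<close>.
\<close>
lemma no_entering_arc_cong:
  assumes "multigraph H" "orientation_of H \<O>" "orientation_of H \<O>'"
    and "orientation_divisor \<O> = orientation_divisor \<O>'"
    and "\<And>e. e \<in> edges H \<Longrightarrow> head \<O> e \<in> R \<Longrightarrow> tail \<O> e \<in> R"
    and "e \<in> edges H" "head \<O>' e \<in> R"
  shows "tail \<O>' e \<in> R"
proof -
  let ?A = "{e \<in> edges H. head \<O> e \<in> R}" and ?B = "{e \<in> edges H. head \<O>' e \<in> R}"
  have "int (card ?A) = int (card ?B)"
    using assms(4) unfolding card_heads[OF assms(1,2)] card_heads[OF assms(1,3)]
    by (simp add: orientation_divisor_eq[OF assms(1,2)] orientation_divisor_eq[OF assms(1,3)])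
  moreover have A: "ends H e \<subseteq> R" if "e \<in> ?A" for e
    using that assms(5) orientation_arc[OF assms(2)] by auto
  then have "?A \<subseteq> ?B" using orientation_arc[OF assms(3)] by auto
  moreover have "finite ?B" using assms(1) by (simp add: multigraph_def)
  ultimately have "?A = ?B" by (simp add: card_subset_eq)
  then have "e \<in> ?A" using assms(6,7) by blast
  then show ?thesis using A orientation_arc[OF assms(3,6)] by blast
qed

text \<open>No arc of \<open>\<O>\<close> leaves the set reachable from \<open>u\<close>, that is,
  none enters its complement. The divisor detects this, so it holds for \<open>\<O>'\<close> as
  well, whose reachable set is then contained in that of \<open>\<O>\<close>. The argument is
  symmetric.\<close>

lemma reachable_set_cong:
  assumes "multigraph H" "orientation_of H \<O>" "orientation_of H \<O>'" "u \<in> nodes H"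
    and "orientation_divisor \<O> = orientation_divisor \<O>'"
  shows "reachable_set \<O> u = reachable_set \<O>' u"
proof -
  have "reachable_set \<O>' u \<subseteq> reachable_set \<O> u"
    if \<O>: "orientation_of H \<O>" "orientation_of H \<O>'"
      "orientation_divisor \<O> = orientation_divisor \<O>'" for \<O> \<O>'
  proof
    fix x assume "x \<in> reachable_set \<O>' u"
    then have "u \<rightarrow>\<^sup>*\<^bsub>\<O>'\<^esub> x" by (simp add: reachable_set_def)
    then show "x \<in> reachable_set \<O> u"
    proof (rule reachable_closed[OF assms(1) \<O>(2)])
      show "u \<in> reachable_set \<O> u"
        using reachable_orientation_refl[OF \<O>(1) assms(4)] by (simp add: reachable_set_def)
      fix e assume e: "e \<in> edges H" "tail \<O>' e \<in> reachable_set \<O> u"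
      show "head \<O>' e \<in> reachable_set \<O> u"
        using no_entering_arc_cong[OF assms(1) \<O>, of "- reachable_set \<O> u" e]
          reachable_set_closed[OF assms(1) \<O>(1)] e by blast
    qed
  qed
  with assms(2,3,5) show ?thesis by (metis subset_antisym)
qed

section \<open>Cycles in a spanning tree plus one edge\<close>

lemma first_dart_SomeD: "first_dart es X = Some d \<Longrightarrow> d \<in> set es \<and> dart_edge d \<in> X"
  by (auto simp: first_dart_def find_Some_iff)

text \<open>Used with \<open>Y\<close> the edges of \<open>H\<close> and \<open>X\<close> those of a
  cycle: a cycle through the first enumerated edge of \<open>H\<close> is directed by that
  edge.\<close>

lemma first_dart_subset:
  "first_dart es Y = Some d \<Longrightarrow> dart_edge d \<in> X \<Longrightarrow> X \<subseteq> Y \<Longrightarrow> first_dart es X = Some d"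
  unfolding first_dart_def by (induction es) (auto split: if_splits)

lemma first_dart_None_iff: "first_dart es X = None \<longleftrightarrow> (\<forall>d\<in>set es. dart_edge d \<notin> X)"
  unfolding first_dart_def find_None_iff by blast

lemma sub_multigraphD:
  "sub_multigraph H G \<Longrightarrow> multigraph H"
  "sub_multigraph H G \<Longrightarrow> ends H = ends G"
  by (simp_all add: sub_multigraph_def)

text \<open>\<open>A\<close> is a union of components of \<open>T\<close> without \<open>e\<close>.
  For a spanning tree and an edge \<open>e\<close> crossing \<open>A\<close>, this makes
  \<open>A\<close> one side of the fundamental cut of \<open>e\<close>. As \<open>A\<close> is not
  tied to the vertex set, the notion is stable under complements.\<close>

definition cut_edge :: "('e \<Rightarrow> 'v set) \<Rightarrow> 'e set \<Rightarrow> 'e \<Rightarrow> 'v set \<Rightarrow> bool" where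
  "cut_edge i T e A \<longleftrightarrow> (\<forall>g\<in>T - {e}. \<forall>a b. i g = {a, b} \<longrightarrow> a \<in> A \<longrightarrow> b \<in> A)"

lemma cut_edgeD:
  assumes "cut_edge i T e A" "g \<in> T" "g \<noteq> e" "i g = {a, b}"
  shows "a \<in> A \<longleftrightarrow> b \<in> A"
proof
  show "a \<in> A \<Longrightarrow> b \<in> A" using assms by (auto simp: cut_edge_def)
  have "i g = {b, a}" using assms(4) by (simp add: insert_commute)
  then show "b \<in> A \<Longrightarrow> a \<in> A" using assms(1-3) by (auto simp: cut_edge_def)
qed

lemma cut_edge_compl:
  assumes "cut_edge i T e A"
  shows "cut_edge i T e (- A)"
  unfolding cut_edge_def using cut_edgeD[OF assms] by blast

lemma cut_edge_component:
  assumes "bridges i T" "e \<in> T" "i e = {a, b}"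
  defines "A \<equiv> {x. (a, x) \<in> joined i (T - {e})}"
  shows "cut_edge i T e A" "a \<in> A" "b \<notin> A"
proof -
  show "cut_edge i T e A"
    unfolding cut_edge_def A_def by (auto intro: joined_step)
  show "a \<in> A" by (simp add: A_def)
  show "b \<notin> A" using assms(1-3) by (auto simp: bridges_def A_def)
qed

lemma spanning_tree_ofD:
  assumes "multigraph H" "spanning_tree_of H T"
  shows "T \<subseteq> edges H" "bridges (ends H) T" "nodes H \<noteq> {}"
    "\<And>x y. x \<in> nodes H \<Longrightarrow> y \<in> nodes H \<Longrightarrow> (x, y) \<in> joined (ends H) T"
  using assms(2) by (simp_all add: spanning_tree_of_iff[OF assms(1)])

lemma tree_cycle_dart:
  "directed_cycle (H\<lparr>edges := insert f T\<rparr>) p \<Longrightarrow> (x, g, y) \<in> set p \<Longrightarrow>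
    (g = f \<or> g \<in> T) \<and> ends H g = {x, y}"
  using directed_cycle_dart[of "H\<lparr>edges := insert f T\<rparr>" p x g y] by simp

lemma tree_cycle_chord:
  assumes "multigraph H" "spanning_tree_of H T" "directed_cycle (H\<lparr>edges := insert f T\<rparr>) p"
  obtains x y where "(x, f, y) \<in> set p"
proof (rule ccontr)
  assume "\<not> thesis"
  with that have nf: "\<And>x y. (x, f, y) \<notin> set p" by blast
  note T = spanning_tree_ofD(1)[OF assms(1,2)]
  have "directed_cycle (H\<lparr>edges := T\<rparr>) p"
  proof (rule directed_cycle_transfer[OF assms(3)])
    fix x g y assume g: "(x, g, y) \<in> set p"
    then have "g \<in> T" "ends H g = {x, y}"
      using tree_cycle_dart[OF assms(3) g] nf by auto
    then show "x \<in> nodes (H\<lparr>edges := T\<rparr>) \<and> g \<in> edges (H\<lparr>edges := T\<rparr>) \<and>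
        ends (H\<lparr>edges := T\<rparr>) g = ends (H\<lparr>edges := insert f T\<rparr>) g"
      using multigraph_ends_neq(2)[OF assms(1), of g x y] T by auto
  qed
  then show False using assms(2) by (auto simp: spanning_tree_of_def forest_of_def)
qed

text \<open>The only edges of \<open>T + f\<close> that can cross \<open>A\<close> are
  \<open>e\<close> and \<open>f\<close>. Leaving along \<open>e\<close> uses up \<open>e\<close>, so
  the return into \<open>A\<close> is along \<open>f\<close>; this fixes the direction of
  \<open>f\<close>.\<close>

lemma tree_cycle_enters:
  assumes "directed_cycle (H\<lparr>edges := insert f T\<rparr>) p" "cut_edge (ends H) T e A"
    and "(a, e, b) \<in> set p" "a \<in> A" "b \<notin> A"
  obtains x y where "(x, f, y) \<in> set p" "x \<notin> A" "y \<in> A"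
proof -
  obtain d where d: "d \<in> set p" "fst d \<notin> A" "snd (snd d) \<in> A"
    using directed_cycle_enters[OF assms(1,3), of A] assms(4,5) by auto
  obtain x g y where xy: "d = (x, g, y)" by (cases d)
  have g: "g = f \<or> g \<in> T" "ends H g = {x, y}"
    using tree_cycle_dart[OF assms(1)] d(1) xy by auto
  have "g \<noteq> e" using directed_cycle_dart_unique[OF assms(1,3)] d assms(4) xy by auto
  then have "g = f" using cut_edgeD[OF assms(2) _ _ g(2)] g(1) d xy by auto
  then show ?thesis using that d xy by auto
qed

lemma tree_cycle_leaves:
  assumes "directed_cycle (H\<lparr>edges := insert f T\<rparr>) p" "cut_edge (ends H) T e A"
    and "(x, f, y) \<in> set p" "x \<notin> A" "y \<in> A"
  obtains a b where "(a, e, b) \<in> set p" "a \<in> A" "b \<notin> A"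
proof -
  obtain d where d: "d \<in> set p" "fst d \<in> A" "snd (snd d) \<notin> A"
    using directed_cycle_leaves[OF assms(1,3), of A] assms(4,5) by auto
  obtain a g b where ab: "d = (a, g, b)" by (cases d)
  have g: "g = f \<or> g \<in> T" "ends H g = {a, b}"
    using tree_cycle_dart[OF assms(1)] d(1) ab by auto
  have "g \<noteq> f" using directed_cycle_dart_unique[OF assms(1,3)] d assms(4) ab by auto
  then have "g = e" using cut_edgeD[OF assms(2) _ _ g(2)] g(1) d ab by auto
  then show ?thesis using that d ab by auto
qed

text \<open>A tree edge \<open>g\<close> of \<open>p\<close> lies on \<open>p'\<close> too:
  \<open>p\<close> crosses the fundamental cut of \<open>g\<close> along \<open>f\<close> as well,
  hence so does \<open>p'\<close>, and \<open>p'\<close> needs \<open>g\<close> to cross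
  back.\<close>

lemma tree_cycle_edges_subset:
  assumes "multigraph H" "spanning_tree_of H T"
    and "directed_cycle (H\<lparr>edges := insert f T\<rparr>) p" "directed_cycle (H\<lparr>edges := insert f T\<rparr>) p'"
  shows "dart_edge ` set p \<subseteq> dart_edge ` set p'"
proof
  fix g assume "g \<in> dart_edge ` set p"
  then obtain a b where ab: "(a, g, b) \<in> set p" by force
  obtain x' y' where xy': "(x', f, y') \<in> set p'" by (rule tree_cycle_chord[OF assms(1,2,4)])
  show "g \<in> dart_edge ` set p'"
  proof (cases "g = f")
    case True
    then show ?thesis using xy' by force
  next
    case False
    then have g: "g \<in> T" "ends H g = {a, b}" using tree_cycle_dart[OF assms(3) ab] by auto
    define A where "A = {x. (a, x) \<in> joined (ends H) (T - {g})}"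
    note A = cut_edge_component[OF spanning_tree_ofD(2)[OF assms(1,2)] g, folded A_def]
    obtain x y where xy: "(x, f, y) \<in> set p" "x \<notin> A" "y \<in> A"
      by (rule tree_cycle_enters[OF assms(3) A(1) ab A(2,3)])
    have "{x', y'} = {x, y}"
      using tree_cycle_dart[OF assms(3) xy(1)] tree_cycle_dart[OF assms(4) xy'] by simp
    then have "x' = x \<and> y' = y \<or> x' = y \<and> y' = x" by (auto simp: doubleton_eq_iff)
    then have "\<exists>a b. (a, g, b) \<in> set p'"
    proof
      assume "x' = x \<and> y' = y"
      then show ?thesis using tree_cycle_leaves[OF assms(4) A(1) xy'] xy(2,3) by metis
    next
      \<comment> \<open>Here \<open>p'\<close> runs through \<open>f\<close> the other way, and the
        argument applies to the other side of the cut.\<close>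
      assume "x' = y \<and> y' = x"
      then show ?thesis
        using tree_cycle_leaves[OF assms(4) cut_edge_compl[OF A(1)] xy'] xy(2,3) by (metis ComplI ComplD)
    qed
    then show ?thesis by force
  qed
qed

lemma tree_cycle_edges_eq:
  assumes "multigraph H" "spanning_tree_of H T"
    and "directed_cycle (H\<lparr>edges := insert f T\<rparr>) p" "directed_cycle (H\<lparr>edges := insert f T\<rparr>) p'"
  shows "dart_edge ` set p = dart_edge ` set p'"
  using tree_cycle_edges_subset[OF assms] tree_cycle_edges_subset[OF assms(1,2,4,3)] by blast

text \<open>
  The first dart of the cycle of \<open>T + f\<close> determines how \<open>f\<close> is traversed: the cycle leaves one side
  of the fundamental cut of that dart along the dart and returns along \<open>f\<close>.
\<close>
lemma chip_vertex_unique: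
  assumes "multigraph H" "spanning_tree_of H T"
    and "directed_cycle (H\<lparr>edges := insert f T\<rparr>) p" "directed_cycle (H\<lparr>edges := insert f T\<rparr>) p'"
    and "first_dart es (dart_edge ` set p) = Some d" "first_dart es (dart_edge ` set p') = Some d'"
    and "d \<in> set p" "d' \<in> set p'" "(x, f, y) \<in> set p" "(x', f, y') \<in> set p'"
  shows "y = y'"
proof -
  have "d' = d" using assms(5,6) tree_cycle_edges_eq[OF assms(1-4)] by simp
  obtain a e b where d: "d = (a, e, b)" by (cases d)
  then have ab: "(a, e, b) \<in> set p" "(a, e, b) \<in> set p'" using assms(7,8) \<open>d' = d\<close> by auto
  show ?thesis
  proof (cases "e = f")
    case True
    then show ?thesis
      using ab directed_cycle_dart_unique[OF assms(3) assms(9)]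
        directed_cycle_dart_unique[OF assms(4) assms(10)] by blast
  next
    case False
    then have e: "e \<in> T" "ends H e = {a, b}" using tree_cycle_dart[OF assms(3) ab(1)] by auto
    define A where "A = {x. (a, x) \<in> joined (ends H) (T - {e})}"
    note A = cut_edge_component[OF spanning_tree_ofD(2)[OF assms(1,2)] e, folded A_def]
    have "x \<notin> A" "y \<in> A"
      using tree_cycle_enters[OF assms(3) A(1) ab(1) A(2,3)]
        directed_cycle_dart_unique[OF assms(3) assms(9)] by metis+
    moreover have "x' \<notin> A" "y' \<in> A"
      using tree_cycle_enters[OF assms(4) A(1) ab(2) A(2,3)]
        directed_cycle_dart_unique[OF assms(4) assms(10)] by metis+
    moreover have "{x, y} = {x', y'}"
      using tree_cycle_dart[OF assms(3) assms(9)] tree_cycle_dart[OF assms(4) assms(10)] by simp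
    ultimately show ?thesis by (auto simp: doubleton_eq_iff)
  qed
qed

lemma chip_vertex_eq:
  assumes "multigraph H" "spanning_tree_of H T"
    and "directed_cycle (H\<lparr>edges := insert f T\<rparr>) p"
    and "first_dart es (dart_edge ` set p) = Some d" "d \<in> set p" "(x, f, y) \<in> set p"
  shows "chip_vertex es H T f = y"
  unfolding chip_vertex_def
proof (rule the_equality)
  show "\<exists>p d x. directed_cycle (H\<lparr>edges := insert f T\<rparr>) p \<and>
      first_dart es (dart_edge ` set p) = Some d \<and> d \<in> set p \<and> (x, f, y) \<in> set p"
    using assms(3-6) by blast
next
  fix y' assume "\<exists>p d x. directed_cycle (H\<lparr>edges := insert f T\<rparr>) p \<and>
      first_dart es (dart_edge ` set p) = Some d \<and> d \<in> set p \<and> (x, f, y') \<in> set p"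
  then obtain p' d' x' where "directed_cycle (H\<lparr>edges := insert f T\<rparr>) p'"
    "first_dart es (dart_edge ` set p') = Some d'" "d' \<in> set p'" "(x', f, y') \<in> set p'" by blast
  then show "y' = y"
    using chip_vertex_unique[OF assms(1,2) _ assms(3) _ assms(4) _ assms(5) _ assms(6)] by blast
qed

section \<open>Chips of the edges outside a tree, for a fixed enumeration\<close>

locale enumerated_multigraph =
  fixes G :: "('v, 'e) mgraph" and F :: "'e set" and es :: "('v, 'e) dart list"
  assumes multigraph_G: "multigraph G" and forest_F: "forest_of G F"
    and enumeration: "oriented_enumeration G F es"
begin

lemma first_dart_ends:
  assumes "sub_multigraph H G" "first_dart es X = Some (a, e, b)"
  shows "e \<in> X" "ends H e = {a, b}"
proof -
  have "(a, e, b) \<in> set es" "e \<in> X" using first_dart_SomeD[OF assms(2)] by auto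
  then have "(a, e, b) \<in> arcs (dart_digraph G)"
    using enumeration by (auto simp: oriented_enumeration_def)
  then show "ends H e = {a, b}" "e \<in> X"
    using sub_multigraphD(2)[OF assms(1)] \<open>e \<in> X\<close> by simp_all
qed

text \<open>A cycle without enumerated edges would consist of edges of \<open>F\<close>, which is
  acyclic.\<close>

lemma cycle_first_dart:
  assumes "sub_multigraph H G" "X \<subseteq> edges H" "directed_cycle (H\<lparr>edges := X\<rparr>) p"
  obtains d where "first_dart es (dart_edge ` set p) = Some d"
proof (cases "first_dart es (dart_edge ` set p)")
  case None
  have "directed_cycle (G\<lparr>edges := F\<rparr>) p"
  proof (rule directed_cycle_transfer[OF assms(3)])
    fix x g y assume g: "(x, g, y) \<in> set p"
    then have *: "g \<in> X" "ends H g = {x, y}" using directed_cycle_dart[OF assms(3) g] by auto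
    then have "g \<in> edges G" "x \<in> nodes G"
      using assms(1,2) multigraph_ends_neq(2)[of H g x y] by (auto simp: sub_multigraph_def)
    moreover have "g \<notin> set (map dart_edge es)"
      using None g by (force simp: first_dart_None_iff)
    ultimately show "x \<in> nodes (G\<lparr>edges := F\<rparr>) \<and> g \<in> edges (G\<lparr>edges := F\<rparr>) \<and>
        ends (G\<lparr>edges := F\<rparr>) g = ends (H\<lparr>edges := X\<rparr>) g"
      using enumeration assms(1) by (auto simp: oriented_enumeration_def sub_multigraph_def)
  qed
  then show ?thesis using forest_F by (auto simp: forest_of_def)
qed (use that in blast)

text \<open>Shows that the definite description in \<open>chip_vertex\<close> has a witness. The
  cycles \<open>p1\<close> and \<open>p2\<close> run through \<open>f\<close> in opposite
  directions, with the same edges and so the same first dart \<open>d\<close>; one of them traverses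
  \<open>d\<close> as prescribed.\<close>

lemma chip_vertexE:
  assumes "sub_multigraph H G" "spanning_tree_of H T" "f \<in> edges H - T"
  obtains p d x where "directed_cycle (H\<lparr>edges := insert f T\<rparr>) p"
    "first_dart es (dart_edge ` set p) = Some d" "d \<in> set p" "(x, f, chip_vertex es H T f) \<in> set p"
proof -
  note mg = sub_multigraphD(1)[OF assms(1)]
  note T = spanning_tree_ofD[OF mg assms(2)]
  have f: "f \<in> edges H" "f \<notin> T" using assms(3) by auto
  obtain x y where xy: "ends H f = {x, y}" "x \<in> nodes H" "y \<in> nodes H"
    by (rule multigraph_ends[OF mg f(1)])
  then have yx: "ends H f = {y, x}" by (simp add: insert_commute)
  obtain p1 where p1: "directed_cycle (H\<lparr>edges := insert f T\<rparr>) p1" "(y, f, x) \<in> set p1"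
    by (rule directed_cycle_exists[OF mg f(1) T(1) f(2) xy(1) T(4)[OF xy(2,3)]])
  obtain p2 where p2: "directed_cycle (H\<lparr>edges := insert f T\<rparr>) p2" "(x, f, y) \<in> set p2"
    by (rule directed_cycle_exists[OF mg f(1) T(1) f(2) yx T(4)[OF xy(3,2)]])
  have same: "dart_edge ` set p2 = dart_edge ` set p1"
    by (rule tree_cycle_edges_eq[OF mg assms(2) p2(1) p1(1)])
  have "insert f T \<subseteq> edges H" using T(1) f by auto
  then obtain d where d: "first_dart es (dart_edge ` set p1) = Some d"
    by (rule cycle_first_dart[OF assms(1) _ p1(1)])
  obtain a e b where abe: "d = (a, e, b)" by (cases d)
  have e: "e \<in> dart_edge ` set p1" "ends H e = {a, b}"
    using first_dart_ends[OF assms(1)] d abe by auto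
  have "d \<in> set p1 \<or> d \<in> set p2"
  proof (cases "e = f")
    case True
    then have "a = y \<and> b = x \<or> a = x \<and> b = y" using e(2) xy(1) by (auto simp: doubleton_eq_iff)
    then show ?thesis using p1(2) p2(2) abe True by auto
  next
    case False
    obtain a' b' where a': "(a', e, b') \<in> set p1" using e(1) by force
    then have eT: "e \<in> T" "ends H e = {a', b'}" using tree_cycle_dart[OF p1(1) a'] False by auto
    then have "a' = a \<and> b' = b \<or> a' = b \<and> b' = a" using e(2) by (auto simp: doubleton_eq_iff)
    then show ?thesis
    proof
      \<comment> \<open>In this case \<open>p1\<close> enters the side \<open>A\<close> of
        \<open>a\<close> along \<open>e\<close> and leaves it along \<open>f\<close>. Hence
        \<open>p2\<close> enters \<open>A\<close> along \<open>f\<close> and has to leave it along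
        \<open>e\<close>, from \<open>a\<close> to \<open>b\<close>.\<close>
      assume "a' = b \<and> b' = a"
      then have ba: "(b, e, a) \<in> set p1" using a' by simp
      define A where "A = {x. (a, x) \<in> joined (ends H) (T - {e})}"
      note A = cut_edge_component[OF T(2) eT(1) e(2), folded A_def]
      obtain x' y' where "(x', f, y') \<in> set p1" "x' \<notin> - A" "y' \<in> - A"
        by (rule tree_cycle_enters[OF p1(1) cut_edge_compl[OF A(1)] ba]) (use A in auto)
      then have "y \<in> A" "x \<notin> A" using directed_cycle_dart_unique[OF p1(1,2)] by auto
      then obtain a'' b'' where ab'': "(a'', e, b'') \<in> set p2" "a'' \<in> A" "b'' \<notin> A"
        using tree_cycle_leaves[OF p2(1) A(1) p2(2)] by blast
      have "{a'', b''} = {a, b}" using tree_cycle_dart[OF p2(1) ab''(1)] e(2) by simp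
      then have "a'' = a \<and> b'' = b" using ab''(2,3) A(2,3) by (auto simp: doubleton_eq_iff)
      then show ?thesis using ab''(1) abe by simp
    qed (use a' abe in auto)
  qed
  then show ?thesis
  proof
    assume "d \<in> set p1"
    with p1 d that chip_vertex_eq[OF mg assms(2) p1(1) d _ p1(2)] show ?thesis by metis
  next
    assume d2: "d \<in> set p2"
    have d': "first_dart es (dart_edge ` set p2) = Some d" using d same by simp
    with p2 d2 that chip_vertex_eq[OF mg assms(2) p2(1) d' d2 p2(2)] show ?thesis by metis
  qed
qed

lemma chip_vertex_in_ends:
  assumes "sub_multigraph H G" "spanning_tree_of H T" "f \<in> edges H - T"
  shows "chip_vertex es H T f \<in> ends H f"
proof -
  obtain p d x where "directed_cycle (H\<lparr>edges := insert f T\<rparr>) p" "(x, f, chip_vertex es H T f) \<in> set p"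
    by (rule chip_vertexE[OF assms])
  then show ?thesis using tree_cycle_dart by fastforce
qed

lemma break_divisor_tree_divisor:
  assumes "sub_multigraph H G" "spanning_tree_of H T"
  shows "break_divisor H (\<phi> es H T)"
  using assms chip_vertex_in_ends unfolding break_divisor_def tree_divisor_def by blast

text \<open>\<open>e\<close> precedes all other enumerated edges of \<open>H\<close>, so it directs
  its own cycle and is traversed from \<open>u\<close> to \<open>v\<close>.\<close>

lemma chip_vertex_first:
  assumes "sub_multigraph H G" "spanning_tree_of H T" "e \<notin> T"
    and "first_dart es (edges H) = Some (u, e, v)"
  shows "chip_vertex es H T e = v"
proof -
  have e: "e \<in> edges H" using first_dart_ends[OF assms(1,4)] by simp
  note mg = sub_multigraphD(1)[OF assms(1)]
  note T = spanning_tree_ofD[OF mg assms(2)]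
  obtain p d x where p: "directed_cycle (H\<lparr>edges := insert e T\<rparr>) p"
    "first_dart es (dart_edge ` set p) = Some d" "d \<in> set p" "(x, e, chip_vertex es H T e) \<in> set p"
    using chip_vertexE[OF assms(1,2), of e] e assms(3) by blast
  have "dart_edge ` set p \<subseteq> edges H" using tree_cycle_dart[OF p(1)] e T(1) by fastforce
  then have "first_dart es (dart_edge ` set p) = Some (u, e, v)"
    by (intro first_dart_subset[OF assms(4)]) (use p(4) in force)
  then show ?thesis using p directed_cycle_dart_unique[OF p(1) p(4)] by auto
qed

text \<open>The cycle of \<open>f\<close> crosses the cut along \<open>f\<close> and hence also
  along \<open>e\<close>, its first dart. It leaves \<open>A\<close> from \<open>u\<close> to
  \<open>v\<close>, so it returns into \<open>A\<close> along \<open>f\<close>.\<close>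

lemma chip_vertex_cross:
  assumes "sub_multigraph H G" "spanning_tree_of H T" "f \<in> edges H - T"
    and "first_dart es (edges H) = Some (u, e, v)" "cut_edge (ends H) T e A" "u \<in> A" "v \<notin> A"
    and "ends H f = {x, y}" "x \<notin> A" "y \<in> A"
  shows "chip_vertex es H T f = y"
proof -
  note e = first_dart_ends[OF assms(1,4)]
  note mg = sub_multigraphD(1)[OF assms(1)]
  note T = spanning_tree_ofD[OF mg assms(2)]
  obtain p d x' where p: "directed_cycle (H\<lparr>edges := insert f T\<rparr>) p"
    "first_dart es (dart_edge ` set p) = Some d" "d \<in> set p" "(x', f, chip_vertex es H T f) \<in> set p"
    by (rule chip_vertexE[OF assms(1-3)])
  define y' where "y' = chip_vertex es H T f"
  have xy': "(x', f, y') \<in> set p" using p(4) by (simp add: y'_def)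
  have "{x', y'} = {x, y}" using tree_cycle_dart[OF p(1) xy'] assms(8) by simp
  then have cases: "x' = x \<and> y' = y \<or> x' = y \<and> y' = x" by (auto simp: doubleton_eq_iff)
  have "\<exists>a b. (a, e, b) \<in> set p"
    using cases
  proof
    assume "x' = x \<and> y' = y"
    then show ?thesis using tree_cycle_leaves[OF p(1) assms(5) xy'] assms(9,10) by metis
  next
    assume "x' = y \<and> y' = x"
    then show ?thesis
      using tree_cycle_leaves[OF p(1) cut_edge_compl[OF assms(5)] xy'] assms(9,10)
      by (metis ComplI ComplD)
  qed
  then have "e \<in> dart_edge ` set p" by force
  moreover have "dart_edge ` set p \<subseteq> edges H"
    using tree_cycle_dart[OF p(1)] T(1) assms(3) by fastforce
  ultimately have "first_dart es (dart_edge ` set p) = Some (u, e, v)"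
    using first_dart_subset[OF assms(4)] by simp
  then have "(u, e, v) \<in> set p" using p(2,3) by simp
  then obtain x'' y'' where "(x'', f, y'') \<in> set p" "y'' \<in> A"
    by (rule tree_cycle_enters[OF p(1) assms(5) _ assms(6,7)])
  then have "y' \<in> A" using directed_cycle_dart_unique[OF p(1) xy'] by auto
  then show ?thesis using cases assms(9,10) y'_def by auto
qed

end

section \<open>Deleting an edge and splitting along a cut\<close>

lemma induced_simps [simp]:
  "nodes (induced H S) = S"
  "edges (induced H S) = {e \<in> edges H. ends H e \<subseteq> S}"
  "ends (induced H S) = ends H"
  by (simp_all add: induced_def)

lemma delete_edge_simps [simp]:
  "nodes (delete_edge H e) = nodes H"
  "edges (delete_edge H e) = edges H - {e}"
  "ends (delete_edge H e) = ends H"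
  by (simp_all add: delete_edge_def)

lemma multigraph_induced: "multigraph H \<Longrightarrow> S \<subseteq> nodes H \<Longrightarrow> multigraph (induced H S)"
  by (auto simp: multigraph_def intro: finite_subset)

lemma multigraph_delete_edge: "multigraph H \<Longrightarrow> multigraph (delete_edge H e)"
  by (auto simp: multigraph_def)

lemma sub_multigraph_induced:
  "sub_multigraph H G \<Longrightarrow> S \<subseteq> nodes H \<Longrightarrow> sub_multigraph (induced H S) G"
  by (auto simp: sub_multigraph_def multigraph_induced)

lemma sub_multigraph_delete_edge: "sub_multigraph H G \<Longrightarrow> sub_multigraph (delete_edge H e) G"
  by (auto simp: sub_multigraph_def multigraph_delete_edge)

lemma orientation_delete_edge:
  "orientation_of H \<O> \<Longrightarrow> orientation_of (delete_edge H e) (\<O>\<lparr>arcs := edges H - {e}\<rparr>)"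
  by (simp add: orientation_of_def)

lemma orientation_induced:
  "orientation_of H \<O> \<Longrightarrow>
    orientation_of (induced H S) (\<O>\<lparr>verts := S, arcs := edges (induced H S)\<rparr>)"
  by (simp add: orientation_of_def)

lemma root_connected_delete_edge:
  assumes "multigraph H" "orientation_of H \<O>" "e \<in> edges H" "root_connected \<O> (head \<O> e)"
  shows "root_connected (\<O>\<lparr>arcs := edges H - {e}\<rparr>) (head \<O> e)"
proof -
  let ?\<O> = "\<O>\<lparr>arcs := edges H - {e}\<rparr>"
  have mg: "multigraph (delete_edge H e)" by (rule multigraph_delete_edge[OF assms(1)])
  note \<O>' = orientation_delete_edge[OF assms(2), of e]
  have q: "head \<O> e \<in> nodes H"
    using multigraph_ends_neq(3)[OF assms(1,3)] orientation_arc[OF assms(2,3)] by blast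
  show ?thesis unfolding root_connected_def
  proof
    fix x assume "x \<in> verts ?\<O>"
    then have "head \<O> e \<rightarrow>\<^sup>*\<^bsub>\<O>\<^esub> x" using assms(4) by (simp add: root_connected_def)
    then have "x \<in> {z. head \<O> e \<rightarrow>\<^sup>*\<^bsub>?\<O>\<^esub> z}"
    proof (rule reachable_closed[OF assms(1,2)])
      show *: "head \<O> e \<in> {z. head \<O> e \<rightarrow>\<^sup>*\<^bsub>?\<O>\<^esub> z}"
        using reachable_orientation_refl[OF \<O>'] q by simp
      fix g assume g: "g \<in> edges H" "tail \<O> g \<in> {z. head \<O> e \<rightarrow>\<^sup>*\<^bsub>?\<O>\<^esub> z}"
      show "head \<O> g \<in> {z. head \<O> e \<rightarrow>\<^sup>*\<^bsub>?\<O>\<^esub> z}"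
      proof (cases "g = e")
        case False
        then show ?thesis using reachable_arc[OF mg \<O>', of "head \<O> e" g] g by simp
      qed (use * in simp)
    qed
    then show "head \<O> e \<rightarrow>\<^sup>*\<^bsub>?\<O>\<^esub> x" by simp
  qed
qed

text \<open>If no arc leaves \<open>S\<close>, walks from \<open>q\<close> stay in \<open>S\<close>;
  if no arc enters \<open>S\<close>, a walk that ends in \<open>S\<close> has been there all the
  time. The first case serves the reachable set of the algorithm, the second its complement.\<close>

lemma root_connected_induced:
  assumes "multigraph H" "orientation_of H \<O>" "S \<subseteq> nodes H" "q \<in> S"
    and "\<And>x. x \<in> S \<Longrightarrow> q \<rightarrow>\<^sup>*\<^bsub>\<O>\<^esub> x"
    and "(\<forall>g\<in>edges H. tail \<O> g \<in> S \<longrightarrow> head \<O> g \<in> S) \<or>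
      (\<forall>g\<in>edges H. head \<O> g \<in> S \<longrightarrow> tail \<O> g \<in> S)"
  shows "root_connected (\<O>\<lparr>verts := S, arcs := edges (induced H S)\<rparr>) q"
proof -
  let ?\<O> = "\<O>\<lparr>verts := S, arcs := edges (induced H S)\<rparr>"
  have mg: "multigraph (induced H S)" by (rule multigraph_induced[OF assms(1,3)])
  note \<O>' = orientation_induced[OF assms(2), of S]
  have q: "q \<rightarrow>\<^sup>*\<^bsub>?\<O>\<^esub> q" using reachable_orientation_refl[OF \<O>'] assms(4) by simp
  have step: "q \<rightarrow>\<^sup>*\<^bsub>?\<O>\<^esub> head \<O> g"
    if "g \<in> edges H" "q \<rightarrow>\<^sup>*\<^bsub>?\<O>\<^esub> tail \<O> g" "tail \<O> g \<in> S" "head \<O> g \<in> S" for g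
    using reachable_arc[OF mg \<O>', of q g] that orientation_arc[OF assms(2) that(1)] by simp
  show ?thesis unfolding root_connected_def
  proof
    fix x assume "x \<in> verts ?\<O>"
    then have x: "x \<in> S" "q \<rightarrow>\<^sup>*\<^bsub>\<O>\<^esub> x" using assms(5) by simp_all
    from assms(6) show "q \<rightarrow>\<^sup>*\<^bsub>?\<O>\<^esub> x"
    proof
      assume "\<forall>g\<in>edges H. tail \<O> g \<in> S \<longrightarrow> head \<O> g \<in> S"
      then have "x \<in> {z \<in> S. q \<rightarrow>\<^sup>*\<^bsub>?\<O>\<^esub> z}"
        by (intro reachable_closed[OF assms(1,2) x(2)]) (use q assms(4) step in auto)
      then show ?thesis by simp
    next
      assume "\<forall>g\<in>edges H. head \<O> g \<in> S \<longrightarrow> tail \<O> g \<in> S"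
      then have "x \<in> {z. z \<in> S \<longrightarrow> q \<rightarrow>\<^sup>*\<^bsub>?\<O>\<^esub> z}"
        by (intro reachable_closed[OF assms(1,2) x(2)]) (use q step in auto)
      then show ?thesis using x(1) by simp
    qed
  qed
qed

section \<open>Divisors of restricted orientations\<close>

lemma restrict_divisor_add:
  "restrict_divisor (D + D') S = restrict_divisor D S + restrict_divisor D' S"
  by (auto simp: restrict_divisor_def)

lemma restrict_divisor_diff:
  "restrict_divisor (D - D') S = restrict_divisor D S - restrict_divisor D' S"
  by (auto simp: restrict_divisor_def)

lemma restrict_divisor_chip: "restrict_divisor (chip x) S = (if x \<in> S then chip x else 0)"
  by (auto simp: restrict_divisor_def chip_def)

lemma restrict_divisor_sum_chip:
  assumes "finite A"
  shows "restrict_divisor (\<Sum>e\<in>A. chip (h e)) S = (\<Sum>e\<in>{e \<in> A. h e \<in> S}. chip (h e))"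
proof
  fix x
  have "{e \<in> {e \<in> A. h e \<in> S}. h e = x} = (if x \<in> S then {e \<in> A. h e = x} else {})" by auto
  then show "restrict_divisor (\<Sum>e\<in>A. chip (h e)) S x = (\<Sum>e\<in>{e \<in> A. h e \<in> S}. chip (h e)) x"
    using assms by (simp add: restrict_divisor_def sum_chip_apply)
qed

lemma restrict_orientation_divisor:
  assumes "multigraph H" "orientation_of H \<O>" "S \<subseteq> nodes H"
  shows "restrict_divisor (orientation_divisor \<O>) S =
    (\<Sum>e\<in>{e \<in> edges H. head \<O> e \<in> S}. chip (head \<O> e)) - (\<Sum>x\<in>S. chip x)"
proof -
  have "finite (edges H)" "finite (nodes H)" using assms(1) by (auto simp: multigraph_def)
  moreover have "{x \<in> nodes H. x \<in> S} = S" using assms(3) by auto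
  ultimately show ?thesis
    using restrict_divisor_sum_chip[of "nodes H" "\<lambda>x. x" S]
    by (simp add: orientation_divisor_eq[OF assms(1,2)] restrict_divisor_diff restrict_divisor_sum_chip)
qed

lemma orientation_divisor_induced:
  assumes "multigraph H" "orientation_of H \<O>" "S \<subseteq> nodes H"
  shows "orientation_divisor (\<O>\<lparr>verts := S, arcs := edges (induced H S)\<rparr>) =
    (\<Sum>e\<in>edges (induced H S). chip (head \<O> e)) - (\<Sum>x\<in>S. chip x)"
  using orientation_divisor_eq[OF multigraph_induced[OF assms(1,3)] orientation_induced[OF assms(2)]]
  by simp

lemma orientation_divisor_delete_edge:
  assumes "multigraph H" "orientation_of H \<O>" "e \<in> edges H"
  shows "orientation_divisor (\<O>\<lparr>arcs := edges H - {e}\<rparr>) + chip (head \<O> e) = orientation_divisor \<O>"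
proof -
  from orientation_divisor_eq[OF multigraph_delete_edge[OF assms(1)] orientation_delete_edge[OF assms(2)], of e]
  have "orientation_divisor (\<O>\<lparr>arcs := edges H - {e}\<rparr>) =
      (\<Sum>e\<in>edges H - {e}. chip (head \<O> e)) - (\<Sum>x\<in>nodes H. chip x)" by simp
  moreover have "(\<Sum>g\<in>edges H. chip (head \<O> g)) =
      chip (head \<O> e) + (\<Sum>g\<in>edges H - {e}. chip (head \<O> g))"
    by (rule sum.remove) (use assms in \<open>auto simp: multigraph_def\<close>)
  ultimately show ?thesis
    unfolding orientation_divisor_eq[OF assms(1,2)] by (simp only: algebra_simps)
qed

text \<open>Chips do not cancel. A tree whose chips sum to \<open>0\<close> thus has no edge outside
  it, which is the base case of the recursion.\<close>

lemma sum_chip_eq_0D: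
  assumes "finite A" "(\<Sum>e\<in>A. chip (h e)) = 0"
  shows "A = {}"
proof (rule ccontr)
  assume "A \<noteq> {}"
  then obtain e where "e \<in> A" by blast
  then have "card {f \<in> A. h f = h e} \<noteq> 0" using assms(1) by auto
  moreover have "int (card {f \<in> A. h f = h e}) = 0"
    using sum_chip_apply[OF assms(1), of h "h e"] assms(2) by simp
  ultimately show False by simp
qed

text \<open>A walk leaves \<open>A\<close> only along \<open>e\<close>, from \<open>s\<close>, and
  comes back only at \<open>s\<close>. While it is outside, \<open>s\<close> is kept in place of the
  current vertex, so that excursions are skipped.\<close>

lemma joined_across_cut:
  assumes "(x, z) \<in> joined i X" "x \<in> A" "cut_edge i X e A" "i e = {s, t}" "s \<in> A" "t \<notin> A"
  shows "(x, if z \<in> A then z else s) \<in> joined i {g \<in> X. i g \<subseteq> A}"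
  using assms(1)
proof (induction rule: joined_induct)
  case refl
  then show ?case using assms(2) by simp
next
  case (step y z g)
  show ?case
  proof (cases "g = e")
    case True
    then have "y = s \<and> z = t \<or> y = t \<and> z = s"
      using step.hyps(3) assms(4) by (auto simp: doubleton_eq_iff)
    then show ?thesis using step.IH assms(5,6) by (elim disjE conjE) simp_all
  next
    case False
    have yz: "y \<in> A \<longleftrightarrow> z \<in> A" by (rule cut_edgeD[OF assms(3) step.hyps(2) False step.hyps(3)])
    show ?thesis
    proof (cases "y \<in> A")
      case True
      then have "g \<in> {g \<in> X. i g \<subseteq> A}" using step.hyps yz by simp
      then show ?thesis using step.IH True yz step.hyps(3)
        by (simp add: joined_step[of x y i _ g z])
    qed (use step.IH yz in simp)
  qed
qed

lemma bridges_mono: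
  assumes "bridges i T" "T' \<subseteq> T"
  shows "bridges i T'"
  unfolding bridges_def
proof (intro ballI allI impI notI)
  fix e x y assume e: "e \<in> T'" "i e = {x, y}" "(x, y) \<in> joined i (T' - {e})"
  have "(x, y) \<in> joined i (T - {e})" by (rule joined_mono[OF e(3)]) (use assms(2) in blast)
  then show False using assms e by (auto simp: bridges_def)
qed

lemma spanning_tree_induced:
  assumes "multigraph H" "spanning_tree_of H T" "S \<subseteq> nodes H"
    and "cut_edge (ends H) T e S" "ends H e = {s, t}" "s \<in> S" "t \<notin> S"
  shows "spanning_tree_of (induced H S) (T \<inter> edges (induced H S))"
proof -
  have mg: "multigraph (induced H S)" by (rule multigraph_induced[OF assms(1,3)])
  note T = spanning_tree_ofD[OF assms(1,2)]
  have E: "T \<inter> edges (induced H S) = {g \<in> T. ends H g \<subseteq> S}" using T(1) by auto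
  have "(x, y) \<in> joined (ends H) {g \<in> T. ends H g \<subseteq> S}" if "x \<in> S" "y \<in> S" for x y
    using joined_across_cut[OF T(4)[of x y] that(1) assms(4-7)] that assms(3) by auto
  moreover have "bridges (ends H) {g \<in> T. ends H g \<subseteq> S}" by (rule bridges_mono[OF T(2)]) auto
  ultimately show ?thesis
    unfolding spanning_tree_of_iff[OF mg] E using assms(6) T(1) by auto
qed

text \<open>A connection between the ends of \<open>g\<close> that avoids \<open>g\<close> can be
  pushed by \<open>joined_across_cut\<close> into the side of \<open>g\<close>, where one of the two
  given trees forbids it. Only \<open>e\<close> crosses the cut, so it is a bridge as well.\<close>

lemma spanning_tree_join:
  assumes "multigraph H" "A \<subseteq> nodes H" "e \<in> edges H" "ends H e = {u, v}" "u \<in> A" "v \<notin> A"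
    and "spanning_tree_of (induced H A) T\<^sub>L" "spanning_tree_of (induced H (nodes H - A)) T\<^sub>R"
  defines "T \<equiv> {e} \<union> T\<^sub>L \<union> T\<^sub>R"
  shows "spanning_tree_of H T" "cut_edge (ends H) T e A"
    "T \<inter> edges (induced H A) = T\<^sub>L" "T \<inter> edges (induced H (nodes H - A)) = T\<^sub>R"
proof -
  let ?i = "ends H" and ?B = "nodes H - A"
  have mg: "multigraph (induced H A)" "multigraph (induced H ?B)"
    using assms(1,2) by (simp_all add: multigraph_induced)
  note L = spanning_tree_ofD[OF mg(1) assms(7), simplified]
  note R = spanning_tree_ofD[OF mg(2) assms(8), simplified]
  have ne: "?i g \<noteq> {}" if "g \<in> edges H" for g using multigraph.no_loops[OF assms(1) that] by auto
  have TA: "?i g \<subseteq> A" "g \<in> edges H" if "g \<in> T\<^sub>L" for g using L(1) that by auto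
  have TB: "?i g \<subseteq> ?B" "g \<in> edges H" if "g \<in> T\<^sub>R" for g using R(1) that by auto
  have disj: "T\<^sub>L \<inter> T\<^sub>R = {}"
  proof -
    { fix g assume "g \<in> T\<^sub>L" "g \<in> T\<^sub>R"
      then have "?i g = {}" using TA(1) TB(1) by blast
      then have False using ne TA(2) \<open>g \<in> T\<^sub>L\<close> by blast }
    then show ?thesis by blast
  qed
  have e: "e \<notin> T\<^sub>L" "e \<notin> T\<^sub>R" using TA(1)[of e] TB(1)[of e] assms(4-6) by auto
  have v: "v \<in> ?B" using multigraph_ends_neq(3)[OF assms(1,3,4)] assms(6) by simp
  show cut: "cut_edge ?i T e A"
    unfolding cut_edge_def
  proof (intro ballI allI impI)
    fix g a b assume g: "g \<in> T - {e}" "?i g = {a, b}" "a \<in> A"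
    then have "g \<in> T\<^sub>L \<or> g \<in> T\<^sub>R" by (auto simp: T_def)
    then show "b \<in> A" using TA(1)[of g] TB(1)[of g] g by auto
  qed
  have TL: "{g \<in> T. ?i g \<subseteq> A} = T\<^sub>L"
  proof -
    have "\<not> ?i g \<subseteq> A" if "g \<in> T\<^sub>R" for g using TB[OF that] ne by blast
    then show ?thesis using TA(1) assms(4,6) by (auto simp: T_def)
  qed
  have TR: "{g \<in> T. ?i g \<subseteq> - A} = T\<^sub>R"
  proof -
    have "\<not> ?i g \<subseteq> - A" if "g \<in> T\<^sub>L" for g using TA[OF that] ne by blast
    moreover have "?i g \<subseteq> - A" if "g \<in> T\<^sub>R" for g using TB(1)[OF that] by blast
    ultimately show ?thesis using assms(4,5) by (auto simp: T_def)
  qed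
  have TE: "T \<subseteq> edges H" using TA(2) TB(2) assms(3) by (auto simp: T_def)
  show "T \<inter> edges (induced H A) = T\<^sub>L" using TL TE by auto
  have "?i g \<subseteq> - A \<longleftrightarrow> ?i g \<subseteq> ?B" if "g \<in> T" for g
    using multigraph.ends_in_nodes[OF assms(1), of g] TE that by blast
  then show "T \<inter> edges (induced H ?B) = T\<^sub>R" using TR TE by auto
  have eT: "(u, v) \<in> joined ?i T" by (rule joined_edge[of e]) (use assms(4) in \<open>auto simp: T_def\<close>)
  have conn: "(u, x) \<in> joined ?i T" if "x \<in> nodes H" for x
  proof (cases "x \<in> A")
    case True
    show ?thesis by (rule joined_mono[OF L(4)[OF assms(5) True]]) (auto simp: T_def)
  next
    case False
    have "(v, x) \<in> joined ?i T"
      by (rule joined_mono[OF R(4)]) (use v that False in \<open>auto simp: T_def\<close>)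
    with eT show ?thesis by (rule joined_trans)
  qed
  have "bridges ?i T" unfolding bridges_def
  proof (intro ballI allI impI notI)
    fix g x y assume g: "g \<in> T" "?i g = {x, y}" "(x, y) \<in> joined ?i (T - {g})"
    consider "g = e" | "g \<in> T\<^sub>L" | "g \<in> T\<^sub>R" using g(1) by (auto simp: T_def)
    then show False
    proof cases
      case 1
      have "x = u \<and> y = v \<or> x = v \<and> y = u" using g(2) 1 assms(4) by (auto simp: doubleton_eq_iff)
      then have "(u, v) \<in> joined ?i (T - {e})" using g(3) 1 by (auto intro: joined_sym)
      then have "v \<in> A"
        by (rule joined_closed[OF _ assms(5)]) (use cut in \<open>auto simp: cut_edge_def\<close>)
      then show False using assms(6) by simp
    next
      case 2
      then have xy: "x \<in> A" "y \<in> A" using TA(1) g(2) by auto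
      have "cut_edge ?i (T - {g}) e A" using cut by (auto simp: cut_edge_def)
      from joined_across_cut[OF g(3) xy(1) this assms(4-6)] xy(2)
      have "(x, y) \<in> joined ?i {f \<in> T - {g}. ?i f \<subseteq> A}" by simp
      moreover have "{f \<in> T - {g}. ?i f \<subseteq> A} = T\<^sub>L - {g}" using TL by blast
      ultimately show False using L(2) 2 g(2) by (auto simp: bridges_def)
    next
      case 3
      then have xy: "x \<in> - A" "y \<in> - A" using TB(1) g(2) by auto
      have "cut_edge ?i (T - {g}) e (- A)"
        using cut_edge_compl[OF cut] by (auto simp: cut_edge_def)
      from joined_across_cut[OF g(3) xy(1) this, of v u] xy(2)
      have "(x, y) \<in> joined ?i {f \<in> T - {g}. ?i f \<subseteq> - A}"
        using assms(4-6) by (simp add: insert_commute)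
      moreover have "{f \<in> T - {g}. ?i f \<subseteq> - A} = T\<^sub>R - {g}" using TR by blast
      ultimately show False using R(2) 3 g(2) by (auto simp: bridges_def)
    qed
  qed
  then show "spanning_tree_of H T"
    unfolding spanning_tree_of_iff[OF assms(1)]
    using TE assms(2,5) conn by (blast intro: joined_trans joined_sym)
qed

lemma spanning_tree_delete_edge:
  assumes "multigraph H"
  shows "spanning_tree_of (delete_edge H e) T \<longleftrightarrow> spanning_tree_of H T \<and> e \<notin> T"
  using assms multigraph_delete_edge[OF assms, of e] by (auto simp: spanning_tree_of_iff)

text \<open>\<open>chip_vertex\<close> overwrites the edge set of the graph it is given and sees
  only vertices and incidences.\<close>

lemma chip_vertex_delete_edge: "chip_vertex es (delete_edge H e) T f = chip_vertex es H T f"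
  by (simp add: chip_vertex_def delete_edge_def)

section \<open>The tree divisor under deletion and splitting\<close>

context enumerated_multigraph
begin

text \<open>The deleted edge accounts for the chip at \<open>v\<close>: this is case (b1) seen from
  the tree.\<close>

lemma tree_divisor_delete_edge:
  assumes "sub_multigraph H G" "spanning_tree_of H T" "e \<notin> T"
    and "first_dart es (edges H) = Some (u, e, v)"
  shows "\<phi> es H T = \<phi> es (delete_edge H e) T + chip v"
proof -
  have fin: "finite (edges H - T)"
    using sub_multigraphD(1)[OF assms(1)] by (simp add: multigraph_def)
  have "e \<in> edges H - T" using first_dart_ends[OF assms(1,4)] assms(3) by simp
  from sum.remove[OF fin this, of "\<lambda>f. chip (chip_vertex es H T f)"]
  have "\<phi> es H T = chip v + (\<Sum>f\<in>edges H - T - {e}. chip (chip_vertex es H T f))"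
    by (simp only: tree_divisor_def chip_vertex_first[OF assms])
  moreover have "edges H - T - {e} = edges (delete_edge H e) - T" by auto
  ultimately show ?thesis
    by (simp only: tree_divisor_def chip_vertex_delete_edge add.commute)
qed

text \<open>A cycle of the smaller tree plus \<open>f\<close> is also a cycle of
  \<open>T + f\<close>, and its first dart depends on its edges alone.\<close>

lemma chip_vertex_induced:
  assumes "sub_multigraph H G" "spanning_tree_of H T" "S \<subseteq> nodes H"
    and "spanning_tree_of (induced H S) (T \<inter> edges (induced H S))"
    and "f \<in> edges (induced H S) - T"
  shows "chip_vertex es (induced H S) (T \<inter> edges (induced H S)) f = chip_vertex es H T f"
proof -
  let ?H = "induced H S" and ?T = "T \<inter> edges (induced H S)"
  note mg = sub_multigraphD(1)[OF assms(1)]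
  have f: "f \<in> edges ?H - ?T" using assms(5) by blast
  obtain p d x where p: "directed_cycle (?H\<lparr>edges := insert f ?T\<rparr>) p"
    "first_dart es (dart_edge ` set p) = Some d" "d \<in> set p"
    "(x, f, chip_vertex es ?H ?T f) \<in> set p"
    by (rule chip_vertexE[OF sub_multigraph_induced[OF assms(1,3)] assms(4) f])
  have "directed_cycle (H\<lparr>edges := insert f T\<rparr>) p"
  proof (rule directed_cycle_transfer[OF p(1)])
    fix x g y assume g: "(x, g, y) \<in> set p"
    have "g = f \<or> g \<in> ?T" "ends H g = {x, y}" using tree_cycle_dart[OF p(1) g] by auto
    moreover from this have "x \<in> S" using f by auto
    ultimately show "x \<in> nodes (H\<lparr>edges := insert f T\<rparr>) \<and> g \<in> edges (H\<lparr>edges := insert f T\<rparr>) \<and>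
        ends (H\<lparr>edges := insert f T\<rparr>) g = ends (?H\<lparr>edges := insert f ?T\<rparr>) g"
      using assms(3) by auto
  qed
  from chip_vertex_eq[OF mg assms(2) this p(2-4)] show ?thesis by simp
qed

lemma tree_divisor_induced:
  assumes "sub_multigraph H G" "spanning_tree_of H T" "S \<subseteq> nodes H"
    and "spanning_tree_of (induced H S) (T \<inter> edges (induced H S))"
  shows "\<phi> es (induced H S) (T \<inter> edges (induced H S)) =
    (\<Sum>f\<in>edges (induced H S) - T. chip (chip_vertex es H T f))"
proof -
  have "edges (induced H S) - T \<inter> edges (induced H S) = edges (induced H S) - T" by blast
  then show ?thesis
    unfolding tree_divisor_def using chip_vertex_induced[OF assms] by (intro sum.cong) auto
qed

text \<open>The edges outside \<open>T\<close> lie in \<open>A\<close>, lie in its complement or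
  cross the cut. The crossing ones have their chip on the side of \<open>u\<close>;
  \<open>\<O>\<close> serves to name that end, as no arc of it leaves \<open>A\<close>. These chips
  are the ones subtracted in case (b2).\<close>

lemma tree_divisor_split:
  assumes "sub_multigraph H G" "spanning_tree_of H T" "e \<in> T"
    and "first_dart es (edges H) = Some (u, e, v)"
    and "A \<subseteq> nodes H" "cut_edge (ends H) T e A" "u \<in> A" "v \<notin> A"
    and "orientation_of H \<O>" "\<forall>g\<in>edges H. tail \<O> g \<in> A \<longrightarrow> head \<O> g \<in> A"
  shows "\<phi> es H T = \<phi> es (induced H A) (T \<inter> edges (induced H A)) +
    \<phi> es (induced H (nodes H - A)) (T \<inter> edges (induced H (nodes H - A))) +
    (\<Sum>f\<in>{f \<in> edges H. f \<noteq> e \<and> tail \<O> f \<notin> A \<and> head \<O> f \<in> A}. chip (head \<O> f))"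
    and "spanning_tree_of (induced H A) (T \<inter> edges (induced H A))"
    and "spanning_tree_of (induced H (nodes H - A)) (T \<inter> edges (induced H (nodes H - A)))"
proof -
  let ?B = "nodes H - A" and ?X = "{f \<in> edges H. f \<noteq> e \<and> tail \<O> f \<notin> A \<and> head \<O> f \<in> A}"
  let ?c = "\<lambda>f. chip (chip_vertex es H T f)"
  note mg = sub_multigraphD(1)[OF assms(1)]
  note T = spanning_tree_ofD[OF mg assms(2)]
  note e = first_dart_ends[OF assms(1,4)]
  note o = orientation_arc[OF assms(9)]
  have in_nodes: "tail \<O> f \<in> nodes H" "head \<O> f \<in> nodes H" if "f \<in> edges H" for f
    using multigraph_ends_neq(2,3)[OF mg that o[OF that]] by auto
  have v: "v \<in> ?B" using multigraph_ends_neq(3)[OF mg e] assms(8) by simp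
  show treeA: "spanning_tree_of (induced H A) (T \<inter> edges (induced H A))"
    by (rule spanning_tree_induced[OF mg assms(2,5,6) e(2) assms(7,8)])
  have cutB: "cut_edge (ends H) T e ?B"
    unfolding cut_edge_def
  proof (intro ballI allI impI)
    fix g a b assume g: "g \<in> T - {e}" "ends H g = {a, b}" "a \<in> ?B"
    have "b \<in> nodes H" using multigraph_ends_neq(3)[OF mg _ g(2)] g(1) T(1) by blast
    moreover have "a \<in> A \<longleftrightarrow> b \<in> A" by (rule cut_edgeD[OF assms(6) _ _ g(2)]) (use g(1) in auto)
    ultimately show "b \<in> ?B" using g(3) by simp
  qed
  have e': "ends H e = {v, u}" using e(2) by (simp add: insert_commute)
  show treeB: "spanning_tree_of (induced H ?B) (T \<inter> edges (induced H ?B))"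
    by (rule spanning_tree_induced[OF mg assms(2) _ cutB e' v]) (use assms(7) in auto)
  have fin: "finite (edges H)" using mg by (simp add: multigraph_def)
  have XT: "?X \<inter> T = {}"
  proof -
    have False if "f \<in> ?X" "f \<in> T" for f
      using cut_edgeD[OF assms(6) that(2), of "tail \<O> f" "head \<O> f"] that(1) o[of f] by auto
    then show ?thesis by blast
  qed
  have eA: "f \<in> edges (induced H A) \<longleftrightarrow> f \<in> edges H \<and> tail \<O> f \<in> A \<and> head \<O> f \<in> A" for f
    using o[of f] by auto
  have eB: "f \<in> edges (induced H ?B) \<longleftrightarrow> f \<in> edges H \<and> tail \<O> f \<notin> A \<and> head \<O> f \<notin> A" for f
    using o[of f] in_nodes[of f] by auto
  have split: "edges H - T = (edges (induced H A) - T) \<union> (edges (induced H ?B) - T) \<union> ?X"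
    using XT assms(3,10) by (auto simp: eA eB simp del: induced_simps)
  have disj: "((edges (induced H A) - T) \<union> (edges (induced H ?B) - T)) \<inter> ?X = {}"
    "(edges (induced H A) - T) \<inter> (edges (induced H ?B) - T) = {}"
    by (auto simp: eA eB simp del: induced_simps)
  have "(\<Sum>f\<in>edges H - T. ?c f) = (\<Sum>f\<in>edges (induced H A) - T. ?c f) +
      (\<Sum>f\<in>edges (induced H ?B) - T. ?c f) + (\<Sum>f\<in>?X. ?c f)"
    unfolding split using fin disj by (subst sum.union_disjoint; (subst sum.union_disjoint)?) auto
  moreover have "(\<Sum>f\<in>?X. ?c f) = (\<Sum>f\<in>?X. chip (head \<O> f))"
  proof (rule sum.cong)
    fix f assume f: "f \<in> ?X"
    have "chip_vertex es H T f = head \<O> f"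
      by (rule chip_vertex_cross[OF assms(1,2) _ assms(4,6-8), of f "tail \<O> f"]) (use f XT o in auto)
    then show "?c f = chip (head \<O> f)" by simp
  qed simp
  ultimately show "\<phi> es H T = \<phi> es (induced H A) (T \<inter> edges (induced H A)) +
    \<phi> es (induced H ?B) (T \<inter> edges (induced H ?B)) + (\<Sum>f\<in>?X. chip (head \<O> f))"
    using tree_divisor_induced[OF assms(1,2,5) treeA] tree_divisor_induced[OF assms(1,2) _ treeB]
    by (simp only: tree_divisor_def[of es H T] Diff_subset)
qed

end

section \<open>The recursion\<close>

context enumerated_multigraph
begin

lemma inv_choiceD:
  assumes "sub_multigraph H G" "inv_choice es H D (u, e, v) \<O>"
  shows "first_dart es (edges H) = Some (u, e, v)" "orientation_of H \<O>" "root_connected \<O> v"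
    "D = orientation_divisor \<O> + chip v" "e \<in> edges H" "ends H e = {u, v}"
    "u \<noteq> v" "u \<in> nodes H" "v \<in> nodes H" "u \<in> reachable_set \<O> u"
proof -
  show *: "first_dart es (edges H) = Some (u, e, v)" "orientation_of H \<O>" "root_connected \<O> v"
    "D = orientation_divisor \<O> + chip v"
    using assms(2) by (simp_all add: inv_choice_def)
  show e: "e \<in> edges H" "ends H e = {u, v}" using first_dart_ends[OF assms(1) *(1)] by simp_all
  show "u \<noteq> v" "u \<in> nodes H" "v \<in> nodes H"
    using multigraph_ends_neq[OF sub_multigraphD(1)[OF assms(1)] e] by simp_all
  then show "u \<in> reachable_set \<O> u"
    using reachable_orientation_refl[OF *(2)] by (simp add: reachable_set_def)
qed

lemma inv_choice_head:
  assumes "sub_multigraph H G" "inv_choice es H D (u, e, v) \<O>" "v \<notin> reachable_set \<O> u"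
  shows "tail \<O> e = v" "head \<O> e = u"
proof -
  note c = inv_choiceD[OF assms(1,2)]
  note mg = sub_multigraphD(1)[OF assms(1)]
  have "{u, v} = {tail \<O> e, head \<O> e}" using c(6) orientation_arc[OF c(2,5)] by simp
  moreover have "\<not> (tail \<O> e = u \<and> head \<O> e = v)"
    using reachable_set_closed[OF mg c(2,5), of u] c(10) assms(3) by auto
  ultimately show "tail \<O> e = v" "head \<O> e = u" by (auto simp: doubleton_eq_iff)
qed

text \<open>\<open>D\<close> minus the chip at \<open>v\<close> is the divisor of
  \<open>\<O>\<close>, which equals the divisor of \<open>\<O>\<close> without \<open>e\<close> plus
  a chip at the head of \<open>e\<close>. So the head of \<open>e\<close> has to serve as
  root.\<close>

lemma delete_call:
  assumes "sub_multigraph H G" "inv_choice es H D (u, e, v) \<O>" "v \<in> reachable_set \<O> u"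
  shows "connected_graph (delete_edge H e)" "break_divisor (delete_edge H e) (D - chip v)"
proof -
  note c = inv_choiceD[OF assms(1,2)]
  note mg = sub_multigraphD(1)[OF assms(1)]
  let ?q = "head \<O> e"
  have q: "?q \<in> nodes H"
    using multigraph_ends_neq(3)[OF mg c(5)] orientation_arc[OF c(2,5)] by blast
  \<comment> \<open>The head is \<open>v\<close>, a root by choice, or \<open>u\<close>, which
    reaches \<open>v\<close> and through it everything.\<close>
  have "root_connected \<O> ?q"
  proof (cases "?q = v")
    case False
    then have "?q = u" using orientation_arc[OF c(2,5)] c(6) by (auto simp: doubleton_eq_iff)
    moreover interpret wf_digraph \<O> by (rule orientation_wf[OF mg c(2)])
    have "u \<rightarrow>\<^sup>*\<^bsub>\<O>\<^esub> x" if "x \<in> verts \<O>" for x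
    proof -
      have "u \<rightarrow>\<^sup>*\<^bsub>\<O>\<^esub> v" using assms(3) by (simp add: reachable_set_def)
      also have "v \<rightarrow>\<^sup>*\<^bsub>\<O>\<^esub> x" using c(3) that by (simp add: root_connected_def)
      finally show ?thesis .
    qed
    ultimately show ?thesis by (simp add: root_connected_def)
  qed (use c(3) in simp)
  from root_connected_break[OF multigraph_delete_edge[OF mg] orientation_delete_edge[OF c(2)]
      root_connected_delete_edge[OF mg c(2,5) this]] q
  have "connected_graph (delete_edge H e)"
    "break_divisor (delete_edge H e) (orientation_divisor \<O>)"
    by (simp_all add: orientation_divisor_delete_edge[OF mg c(2,5)])
  then show "connected_graph (delete_edge H e)" "break_divisor (delete_edge H e) (D - chip v)"
    by (simp_all add: c(4))
qed

text \<open>The arcs with head in \<open>U\<close> are those inside \<open>U\<close>, those whose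
  chips are subtracted, and \<open>e\<close>, whose head is \<open>u\<close>; the chip of
  \<open>e\<close> becomes the root chip of the left part. No arc runs from \<open>U\<close> to the
  complement, so there the divisor consists of the arcs inside, and the root \<open>v\<close> keeps
  its chip.\<close>

lemma split_calls:
  assumes "sub_multigraph H G" "inv_choice es H D (u, e, v) \<O>" "v \<notin> reachable_set \<O> u"
  defines "U \<equiv> reachable_set \<O> u"
  shows "connected_graph (induced H U)"
    "break_divisor (induced H U) (restrict_divisor D U -
      (\<Sum>f\<in>{f \<in> edges H. f \<noteq> e \<and> tail \<O> f \<notin> U \<and> head \<O> f \<in> U}. chip (head \<O> f)))"
    "connected_graph (induced H (nodes H - U))"
    "break_divisor (induced H (nodes H - U)) (restrict_divisor D (nodes H - U))"
proof -
  let ?R = "nodes H - U" and ?X = "{f \<in> edges H. f \<noteq> e \<and> tail \<O> f \<notin> U \<and> head \<O> f \<in> U}"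
  note c = inv_choiceD[OF assms(1,2)]
  note mg = sub_multigraphD(1)[OF assms(1)]
  note o = orientation_arc[OF c(2)]
  note e = inv_choice_head[OF assms(1-3)]
  have in_nodes: "tail \<O> f \<in> nodes H" "head \<O> f \<in> nodes H" if "f \<in> edges H" for f
    using multigraph_ends_neq(2,3)[OF mg that o[OF that]] by auto
  have U: "U \<subseteq> nodes H" unfolding U_def by (rule reachable_set_subset[OF mg c(2)])
  have closed: "head \<O> g \<in> U" if "g \<in> edges H" "tail \<O> g \<in> U" for g
    using reachable_set_closed[OF mg c(2) that(1)] that(2) by (simp add: U_def)
  have v: "v \<in> ?R" using c(9) assms(3) by (simp add: U_def)
  then have vU: "v \<notin> U" by simp
  have u: "u \<in> U" using c(10) by (simp add: U_def)
  have fin: "finite (edges H)" using mg by (simp add: multigraph_def)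
  have eU: "f \<in> edges (induced H U) \<longleftrightarrow> f \<in> edges H \<and> tail \<O> f \<in> U" for f
    using o[of f] closed[of f] by auto
  have eR: "f \<in> edges (induced H ?R) \<longleftrightarrow> f \<in> edges H \<and> head \<O> f \<in> ?R" for f
    using o[of f] closed[of f] in_nodes[of f] by auto
  have rootU: "root_connected (\<O>\<lparr>verts := U, arcs := edges (induced H U)\<rparr>) u"
    by (rule root_connected_induced[OF mg c(2) U u])
      (use closed in \<open>auto simp: U_def reachable_set_def\<close>)
  have rootR: "root_connected (\<O>\<lparr>verts := ?R, arcs := edges (induced H ?R)\<rparr>) v"
  proof (rule root_connected_induced[OF mg c(2) _ v])
    fix x assume "x \<in> ?R"
    then show "v \<rightarrow>\<^sup>*\<^bsub>\<O>\<^esub> x" using c(2,3) by (simp add: root_connected_def orientation_of_def)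
  next
    show "(\<forall>g\<in>edges H. tail \<O> g \<in> ?R \<longrightarrow> head \<O> g \<in> ?R) \<or>
        (\<forall>g\<in>edges H. head \<O> g \<in> ?R \<longrightarrow> tail \<O> g \<in> ?R)"
      using closed in_nodes by blast
  qed simp
  have "{f \<in> edges H. head \<O> f \<in> U} = insert e (edges (induced H U) \<union> ?X)"
    using c(5) e u closed by (auto simp: eU simp del: induced_simps)
  moreover have "e \<notin> edges (induced H U) \<union> ?X"
    using e(1) v by (auto simp: eU simp del: induced_simps)
  moreover have "edges (induced H U) \<inter> ?X = {}" by (auto simp: eU simp del: induced_simps)
  ultimately have "(\<Sum>f\<in>{f \<in> edges H. head \<O> f \<in> U}. chip (head \<O> f)) =
      chip u + ((\<Sum>f\<in>edges (induced H U). chip (head \<O> f)) + (\<Sum>f\<in>?X. chip (head \<O> f)))"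
    using fin e(2) by (simp add: sum.union_disjoint)
  \<comment> \<open>Here \<open>a\<close> is the chip of \<open>e\<close>, \<open>b\<close> belongs
    to the arcs inside \<open>U\<close>, \<open>c\<close> to the other arcs entering
    \<open>U\<close>, and \<open>d\<close> to the vertices of \<open>U\<close>.\<close>
  moreover have rearrange: "a + (b + c) - d - c = b - d + a" for a b c d :: "'v divisor"
    by (simp add: algebra_simps)
  ultimately have "restrict_divisor D U - (\<Sum>f\<in>?X. chip (head \<O> f)) =
      orientation_divisor (\<O>\<lparr>verts := U, arcs := edges (induced H U)\<rparr>) + chip u"
    by (simp only: c(4) restrict_divisor_add restrict_divisor_chip vU if_False
        restrict_orientation_divisor[OF mg c(2) U] orientation_divisor_induced[OF mg c(2) U]
        rearrange add_0_right)
  then show "connected_graph (induced H U)"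
    "break_divisor (induced H U) (restrict_divisor D U - (\<Sum>f\<in>?X. chip (head \<O> f)))"
    using root_connected_break[OF multigraph_induced[OF mg U] orientation_induced[OF c(2)] rootU] u
    by simp_all
  have "{f \<in> edges H. head \<O> f \<in> ?R} = edges (induced H ?R)" using eR by blast
  moreover have R: "?R \<subseteq> nodes H" by blast
  ultimately have "restrict_divisor D ?R =
      orientation_divisor (\<O>\<lparr>verts := ?R, arcs := edges (induced H ?R)\<rparr>) + chip v"
    using v by (simp only: c(4) restrict_divisor_add restrict_divisor_chip if_True
        restrict_orientation_divisor[OF mg c(2) R] orientation_divisor_induced[OF mg c(2) R])
  then show "connected_graph (induced H ?R)"
    "break_divisor (induced H ?R) (restrict_divisor D ?R)"
    using root_connected_break[OF multigraph_induced[OF mg R] orientation_induced[OF c(2)] rootR] v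
    by simp_all
qed

lemma inv_b1E:
  assumes "inv_b1 es H D H' D'"
  obtains u e v \<O> where "inv_choice es H D (u, e, v) \<O>" "v \<in> reachable_set \<O> u"
    "H' = delete_edge H e" "D' = D - chip v"
  using assms unfolding inv_b1_def by blast

lemma inv_b2E:
  assumes "inv_b2 es H D e H\<^sub>L D\<^sub>L H\<^sub>R D\<^sub>R"
  obtains u v \<O> U where "inv_choice es H D (u, e, v) \<O>" "U = reachable_set \<O> u" "v \<notin> U"
    "H\<^sub>L = induced H U"
    "D\<^sub>L = restrict_divisor D U -
      (\<Sum>f\<in>{f \<in> edges H. f \<noteq> e \<and> tail \<O> f \<notin> U \<and> head \<O> f \<in> U}. chip (head \<O> f))"
    "H\<^sub>R = induced H (nodes H - U)" "D\<^sub>R = restrict_divisor D (nodes H - U)"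
  using assms unfolding inv_b2_def by blast

lemma b1_call:
  assumes "sub_multigraph H G" "inv_b1 es H D H' D'"
  shows "sub_multigraph H' G" "connected_graph H'" "break_divisor H' D'"
    "card (edges H') < card (edges H)"
proof -
  obtain u e v \<O> where b: "inv_choice es H D (u, e, v) \<O>" "v \<in> reachable_set \<O> u"
    "H' = delete_edge H e" "D' = D - chip v"
    using assms(2) by (rule inv_b1E)
  show "sub_multigraph H' G" "connected_graph H'" "break_divisor H' D'"
    using b delete_call[OF assms(1) b(1,2)] sub_multigraph_delete_edge[OF assms(1)] by simp_all
  have "finite (edges H)" using sub_multigraphD(1)[OF assms(1)] by (simp add: multigraph_def)
  then show "card (edges H') < card (edges H)"
    using card_Diff1_less[OF _ inv_choiceD(5)[OF assms(1) b(1)]]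
    by (simp only: b(3) delete_edge_simps)
qed

lemma b2_call:
  assumes "sub_multigraph H G" "inv_b2 es H D e H\<^sub>L D\<^sub>L H\<^sub>R D\<^sub>R"
  shows "sub_multigraph H\<^sub>L G" "connected_graph H\<^sub>L" "break_divisor H\<^sub>L D\<^sub>L"
    "card (edges H\<^sub>L) < card (edges H)"
    "sub_multigraph H\<^sub>R G" "connected_graph H\<^sub>R" "break_divisor H\<^sub>R D\<^sub>R"
    "card (edges H\<^sub>R) < card (edges H)"
proof -
  obtain u v \<O> U where b: "inv_choice es H D (u, e, v) \<O>" "U = reachable_set \<O> u" "v \<notin> U"
    "H\<^sub>L = induced H U"
    "D\<^sub>L = restrict_divisor D U -
      (\<Sum>f\<in>{f \<in> edges H. f \<noteq> e \<and> tail \<O> f \<notin> U \<and> head \<O> f \<in> U}. chip (head \<O> f))"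
    "H\<^sub>R = induced H (nodes H - U)" "D\<^sub>R = restrict_divisor D (nodes H - U)"
    using assms(2) by (rule inv_b2E)
  note c = inv_choiceD[OF assms(1) b(1)]
  note mg = sub_multigraphD(1)[OF assms(1)]
  have vU: "v \<notin> reachable_set \<O> u" using b(2,3) by simp
  have U: "U \<subseteq> nodes H" unfolding b(2) by (rule reachable_set_subset[OF mg c(2)])
  show "sub_multigraph H\<^sub>L G" "sub_multigraph H\<^sub>R G"
    unfolding b(4,6) by (rule sub_multigraph_induced[OF assms(1)]; use U in blast)+
  show "connected_graph H\<^sub>L" "break_divisor H\<^sub>L D\<^sub>L" "connected_graph H\<^sub>R" "break_divisor H\<^sub>R D\<^sub>R"
    unfolding b(2,4-7) by (rule split_calls[OF assms(1) b(1) vU])+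
  have fin: "finite (edges H)" using mg by (simp add: multigraph_def)
  have "e \<notin> edges H\<^sub>L" "e \<notin> edges H\<^sub>R" using b(2,3,4,6) c(6,10) by auto
  then have "edges H\<^sub>L \<subset> edges H" "edges H\<^sub>R \<subset> edges H" using b(4,6) c(5) by auto
  then show "card (edges H\<^sub>L) < card (edges H)" "card (edges H\<^sub>R) < card (edges H)"
    using psubset_card_mono[OF fin] by auto
qed

lemma inv_call_sub:
  assumes "sub_multigraph H G" "inv_call es (H', D') (H, D)"
  shows "sub_multigraph H' G" "connected_graph H'" "break_divisor H' D'"
    "card (edges H') < card (edges H)"
proof -
  from assms(2) consider "inv_b1 es H D H' D'"
    | e H'' D'' where "inv_b2 es H D e H' D' H'' D''"
    | e H'' D'' where "inv_b2 es H D e H'' D'' H' D'"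
    by (auto simp: inv_call_def)
  then have "sub_multigraph H' G \<and> connected_graph H' \<and> break_divisor H' D' \<and>
      card (edges H') < card (edges H)"
  proof cases
    case 1
    show ?thesis using b1_call[OF assms(1) 1] by simp
  next
    case 2
    show ?thesis using b2_call(1-4)[OF assms(1) 2] by simp
  next
    case 3
    show ?thesis using b2_call(5-8)[OF assms(1) 3] by simp
  qed
  then show "sub_multigraph H' G" "connected_graph H'" "break_divisor H' D'"
    "card (edges H') < card (edges H)" by blast+
qed

text \<open>Every call loses the edge \<open>e\<close> of the current choice, so the number of edges
  decreases whatever orientation was chosen.\<close>

lemma inv_call_terminates:
  "sub_multigraph H G \<Longrightarrow> Wellfounded.accp (inv_call es) (H, D)"
proof (induction "card (edges H)" arbitrary: H D rule: less_induct)
  case less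
  show ?case
  proof (rule accp.accI)
    fix y assume y: "inv_call es y (H, D)"
    obtain H' D' where "y = (H', D')" by (cases y)
    with y less inv_call_sub[OF less.prems] show "Wellfounded.accp (inv_call es) y" by blast
  qed
qed

text \<open>A nonzero \<open>D\<close> has an edge outside its tree. The cycle of this edge contains
  an enumerated edge, so \<open>H\<close> has a first dart, whose head is taken as root of the
  orientation.\<close>

lemma inv_choice_exists:
  assumes "sub_multigraph H G" "break_divisor H D" "D \<noteq> 0"
  obtains u e v \<O> where "inv_choice es H D (u, e, v) \<O>"
proof -
  note mg = sub_multigraphD(1)[OF assms(1)]
  obtain T c where T: "spanning_tree_of H T" "\<forall>f\<in>edges H - T. c f \<in> ends H f"
    and D: "D = (\<Sum>f\<in>edges H - T. chip (c f))"
    using assms(2) by (auto simp: break_divisor_def)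
  note TE = spanning_tree_ofD(1)[OF mg T(1)]
  have "edges H - T \<noteq> {}"
  proof
    assume "edges H - T = {}"
    then have "D = 0" unfolding D by (simp only: sum.empty)
    with assms(3) show False by simp
  qed
  then obtain f where f: "f \<in> edges H - T" by blast
  obtain p d x where p: "directed_cycle (H\<lparr>edges := insert f T\<rparr>) p"
    "first_dart es (dart_edge ` set p) = Some d"
    using chip_vertexE[OF assms(1) T(1) f] by metis
  have "dart_edge ` set p \<subseteq> edges H" using tree_cycle_dart[OF p(1)] TE f by fastforce
  then have "first_dart es (edges H) \<noteq> None"
    using first_dart_SomeD[OF p(2)] unfolding first_dart_None_iff by blast
  then obtain u e v where e: "first_dart es (edges H) = Some (u, e, v)" by auto
  have v: "v \<in> nodes H" using multigraph_ends_neq(3)[OF mg] first_dart_ends[OF assms(1) e] by blast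
  obtain \<O> where \<O>: "orientation_of H \<O>" "root_connected \<O> v"
    "(\<Sum>f\<in>edges H - T. chip (c f)) = orientation_divisor \<O> + chip v"
    by (rule spanning_tree_orientation[OF mg T v]) blast
  then have "inv_choice es H D (u, e, v) \<O>"
    using assms(3) e D by (simp add: inv_choice_def)
  then show ?thesis by (rule that)
qed

lemma inv_returns_exists:
  "sub_multigraph H G \<Longrightarrow> break_divisor H D \<Longrightarrow> \<exists>T. inv_returns es H D T"
proof (induction "card (edges H)" arbitrary: H D rule: less_induct)
  case less
  show ?case
  proof (cases "D = 0")
    case True
    then show ?thesis using inv_returns.zero by blast
  next
    case False
    then obtain u e v \<O> where c: "inv_choice es H D (u, e, v) \<O>"
      using inv_choice_exists[OF less.prems] by blast
    show ?thesis
    proof (cases "v \<in> reachable_set \<O> u")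
      case True
      then have b1: "inv_b1 es H D (delete_edge H e) (D - chip v)"
        using c unfolding inv_b1_def by blast
      then obtain T where "inv_returns es (delete_edge H e) (D - chip v) T"
        using less.hyps b1_call[OF less.prems(1) b1] by blast
      then show ?thesis using inv_returns.b1[OF b1] by blast
    next
      case False
      then obtain H\<^sub>L D\<^sub>L H\<^sub>R D\<^sub>R where b2: "inv_b2 es H D e H\<^sub>L D\<^sub>L H\<^sub>R D\<^sub>R"
        using c unfolding inv_b2_def by blast
      then obtain T\<^sub>L T\<^sub>R where "inv_returns es H\<^sub>L D\<^sub>L T\<^sub>L" "inv_returns es H\<^sub>R D\<^sub>R T\<^sub>R"
        using less.hyps b2_call[OF less.prems(1) b2] by metis
      then show ?thesis using inv_returns.b2[OF b2] by blast
    qed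
  qed
qed

lemma restrict_divisor_split:
  assumes "\<And>x. x \<notin> V \<Longrightarrow> D x = 0"
  shows "restrict_divisor D U + restrict_divisor D (V - U) = D"
  using assms by (auto simp: restrict_divisor_def)

text \<open>Induction along the derivation covers all choices of orientations. In case (b2) the
  chips subtracted before the left call return as those of the edges crossing the cut of
  \<open>e\<close>.\<close>

lemma inv_returns_correct:
  "inv_returns es H D T \<Longrightarrow> sub_multigraph H G \<Longrightarrow> break_divisor H D \<Longrightarrow>
    spanning_tree_of H T \<and> \<phi> es H T = D"
proof (induction rule: inv_returns.induct)
  case (zero H)
  note mg = sub_multigraphD(1)[OF zero(1)]
  obtain T and c :: "'e \<Rightarrow> 'v" where
    "spanning_tree_of H T" "0 = (\<Sum>f\<in>edges H - T. chip (c f))"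
    using zero(2) unfolding break_divisor_def by blast
  note T = this(1) this(2)[symmetric]
  have "edges H - T = {}" by (rule sum_chip_eq_0D[OF _ T(2)]) (use mg in \<open>simp add: multigraph_def\<close>)
  then have "T = edges H" using spanning_tree_ofD(1)[OF mg T(1)] by blast
  moreover have "\<phi> es H (edges H) = 0" unfolding tree_divisor_def Diff_cancel by (rule sum.empty)
  ultimately show ?case using T(1) by simp
next
  case (b1 H D H' D' T)
  note mg = sub_multigraphD(1)[OF b1.prems(1)]
  obtain u e v \<O> where b: "inv_choice es H D (u, e, v) \<O>" "v \<in> reachable_set \<O> u"
    "H' = delete_edge H e" "D' = D - chip v"
    using b1.hyps(1) by (rule inv_b1E)
  have IH: "spanning_tree_of H' T" "\<phi> es H' T = D'"
    using b1.IH b1_call[OF b1.prems(1) b1.hyps(1)] by blast+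
  then have T: "spanning_tree_of H T" "e \<notin> T"
    using spanning_tree_delete_edge[OF mg] b(3) by auto
  show ?case
    using tree_divisor_delete_edge[OF b1.prems(1) T inv_choiceD(1)[OF b1.prems(1) b(1)]] T(1) IH(2) b(3,4)
    by simp
next
  case (b2 H D e H\<^sub>L D\<^sub>L H\<^sub>R D\<^sub>R T\<^sub>L T\<^sub>R)
  note mg = sub_multigraphD(1)[OF b2.prems(1)]
  obtain u v \<O> U where b: "inv_choice es H D (u, e, v) \<O>" "U = reachable_set \<O> u" "v \<notin> U"
    "H\<^sub>L = induced H U"
    "D\<^sub>L = restrict_divisor D U -
      (\<Sum>f\<in>{f \<in> edges H. f \<noteq> e \<and> tail \<O> f \<notin> U \<and> head \<O> f \<in> U}. chip (head \<O> f))"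
    "H\<^sub>R = induced H (nodes H - U)" "D\<^sub>R = restrict_divisor D (nodes H - U)"
    using b2.hyps(1) by (rule inv_b2E)
  note c = inv_choiceD[OF b2.prems(1) b(1)]
  have IH: "spanning_tree_of (induced H U) T\<^sub>L" "\<phi> es (induced H U) T\<^sub>L = D\<^sub>L"
    "spanning_tree_of (induced H (nodes H - U)) T\<^sub>R" "\<phi> es (induced H (nodes H - U)) T\<^sub>R = D\<^sub>R"
    using b2.IH b2_call[OF b2.prems(1) b2.hyps(1)] b(4,6) by blast+
  have U: "U \<subseteq> nodes H" unfolding b(2) by (rule reachable_set_subset[OF mg c(2)])
  have u: "u \<in> U" using c(10) b(2) by simp
  let ?T = "{e} \<union> T\<^sub>L \<union> T\<^sub>R"
  note T = spanning_tree_join[OF mg U c(5,6) u b(3) IH(1,3)]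
  have closed: "\<forall>g\<in>edges H. tail \<O> g \<in> U \<longrightarrow> head \<O> g \<in> U"
    using reachable_set_closed[OF mg c(2)] by (simp add: b(2))
  have "\<phi> es H ?T = D\<^sub>L + D\<^sub>R +
      (\<Sum>f\<in>{f \<in> edges H. f \<noteq> e \<and> tail \<O> f \<notin> U \<and> head \<O> f \<in> U}. chip (head \<O> f))"
    using tree_divisor_split(1)[OF b2.prems(1) T(1) _ c(1) U T(2) u b(3) c(2) closed]
    unfolding T(3,4) IH(2,4) by simp
  also have "\<dots> = restrict_divisor D U + restrict_divisor D (nodes H - U)"
    unfolding b(5,7) by (simp add: algebra_simps)
  also have "\<dots> = D"
    by (rule restrict_divisor_split)
      (use c(2,9) in \<open>auto simp: c(4) orientation_divisor_def orientation_of_def chip_def\<close>)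
  finally show ?case using T(1) by simp
qed

text \<open>
  The orientation chosen by the algorithm may be replaced by the one in which \<open>T\<close> points away from
  \<open>v\<close> and every other edge points to its chip, since reachability depends on the divisor only.
\<close>
lemma inv_choice_tree:
  assumes "sub_multigraph H G" "spanning_tree_of H T"
    and "inv_choice es H (\<phi> es H T) (u, e, v) \<O>"
  shows "v \<in> reachable_set \<O> u \<longleftrightarrow> e \<notin> T"
    "e \<in> T \<Longrightarrow> cut_edge (ends H) T e (reachable_set \<O> u)"
proof -
  note mg = sub_multigraphD(1)[OF assms(1)]
  note c = inv_choiceD[OF assms(1,3)]
  note T = spanning_tree_ofD[OF mg assms(2)]
  have chips: "\<forall>f\<in>edges H - T. chip_vertex es H T f \<in> ends H f"
    using chip_vertex_in_ends[OF assms(1,2)] by blast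
  obtain \<O>' P where \<O>': "orientation_of H \<O>'" and "root_connected \<O>' v"
    and D: "(\<Sum>f\<in>edges H - T. chip (chip_vertex es H T f)) = orientation_divisor \<O>' + chip v"
    and heads: "\<forall>f\<in>edges H - T. head \<O>' f = chip_vertex es H T f"
    and P: "arborescence (ends H) v (nodes H) P" "dart_edge ` P = T"
    and darts': "\<forall>a e b. (a, e, b) \<in> P \<longrightarrow> tail \<O>' e = a \<and> head \<O>' e = b"
    by (rule spanning_tree_orientation[OF mg assms(2) chips c(9)]) blast
  have darts: "tail \<O>' e = a" "head \<O>' e = b" if "(a, e, b) \<in> P" for a e b
    using darts' that by auto
  note o = orientation_arc[OF \<O>']
  have "orientation_divisor \<O> + chip v = orientation_divisor \<O>' + chip v"
    using c(4) D by (simp only: tree_divisor_def)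
  then have "orientation_divisor \<O> = orientation_divisor \<O>'" by (rule add_right_imp_eq)
  then have W: "reachable_set \<O> u = reachable_set \<O>' u"
    by (rule reachable_set_cong[OF mg c(2) \<O>' c(8)])
  define W where "W = reachable_set \<O>' u"
  have u: "u \<in> W" using reachable_orientation_refl[OF \<O>' c(8)] by (simp add: W_def reachable_set_def)
  have closed: "head \<O>' g \<in> W" if "g \<in> edges H" "tail \<O>' g \<in> W" for g
    using reachable_set_closed[OF mg \<O>' that(1)] that(2) by (simp add: W_def)
  have *: "(v \<in> W \<longleftrightarrow> e \<notin> T) \<and> (e \<in> T \<longrightarrow> cut_edge (ends H) T e W)"
  proof (cases "e \<in> T")
    case False
    \<comment> \<open>Outside \<open>T\<close> the edge \<open>e\<close> carries its chip at
      \<open>v\<close>, so \<open>\<O>'\<close> directs it from \<open>u\<close> to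
      \<open>v\<close>.\<close>
    have "head \<O>' e = v" using heads chip_vertex_first[OF assms(1,2) False c(1)] c(5) False by simp
    then have "tail \<O>' e = u" using o[OF c(5)] c(6,7) by (auto simp: doubleton_eq_iff)
    then have "v \<in> W" using closed[OF c(5)] u \<open>head \<O>' e = v\<close> by simp
    with False show ?thesis by simp
  next
    case True
    define A where "A = {x. (u, x) \<in> joined (ends H) (T - {e})}"
    note A = cut_edge_component[OF T(2) True c(6), folded A_def]
    obtain a b where ab: "(a, e, b) \<in> P" using True P(2) by force
    have "{a, b} = {u, v}" "b \<noteq> v" using arborescence_dart(1,5)[OF P(1) ab] c(6) by auto
    then have "a = v" "b = u" by (auto simp: doubleton_eq_iff)
    then have e: "tail \<O>' e = v" "head \<O>' e = u" using darts[OF ab] by auto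
    \<comment> \<open>No arc of \<open>\<O>'\<close> leaves \<open>A\<close>: \<open>e\<close>
      enters it, other tree edges do not cross, and crossing edges outside \<open>T\<close> point to
      their chip, which lies in \<open>A\<close>.\<close>
    have WA: "W \<subseteq> A"
    proof
      fix x assume "x \<in> W"
      then have "u \<rightarrow>\<^sup>*\<^bsub>\<O>'\<^esub> x" by (simp add: W_def reachable_set_def)
      then show "x \<in> A"
      proof (rule reachable_closed[OF mg \<O>' _ A(2)])
        fix g assume g: "g \<in> edges H" "tail \<O>' g \<in> A"
        show "head \<O>' g \<in> A"
        proof (cases "g \<in> T")
          case True
          then show ?thesis using e A(2) cut_edgeD[OF A(1) True _ o[OF g(1)]] g(2) by (cases "g = e") auto
        next
          case False
          then have gT: "g \<in> edges H - T" using g(1) by simp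
          have og: "ends H g = {head \<O>' g, tail \<O>' g}" using o[OF g(1)] by auto
          show ?thesis
          proof (rule ccontr)
            assume n: "head \<O>' g \<notin> A"
            have "chip_vertex es H T g = tail \<O>' g"
              by (rule chip_vertex_cross[OF assms(1,2) gT c(1) A(1-3) og n g(2)])
            then show False using heads gT n g(2) by simp
          qed
        qed
      qed
    qed
    \<comment> \<open>Descending from the root \<open>v\<close>, which is outside \<open>A\<close>,
      the arborescence enters \<open>A\<close> only along \<open>e\<close>, hence at
      \<open>u\<close>; from there tree arcs stay inside the reachable set.\<close>
    have "nodes H \<subseteq> {x. x \<in> A \<longrightarrow> x \<in> W}"
    proof (rule arborescence_closed[OF P(1)])
      fix a g b assume g: "(a, g, b) \<in> P" "a \<in> {x. x \<in> A \<longrightarrow> x \<in> W}"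
      have gT: "g \<in> T" using g(1) P(2) by force
      show "b \<in> {x. x \<in> A \<longrightarrow> x \<in> W}"
      proof (cases "g = e")
        case True
        then show ?thesis using darts[OF g(1)] e u by simp
      next
        case False
        have "a \<in> A \<longleftrightarrow> b \<in> A" by (rule cut_edgeD[OF A(1) gT False arborescence_dart(1)[OF P(1) g(1)]])
        then show ?thesis using closed[of g] darts[OF g(1)] gT T(1) g(2) by auto
      qed
    qed (use A(3) in simp)
    then have AW: "x \<in> W" if "x \<in> A" "x \<in> nodes H" for x using that by blast
    have "cut_edge (ends H) T e W"
      unfolding cut_edge_def
    proof (intro ballI allI impI)
      fix g a b assume g: "g \<in> T - {e}" "ends H g = {a, b}" "a \<in> W"
      have "b \<in> A" using cut_edgeD[OF A(1) _ _ g(2)] g(1,3) WA by auto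
      moreover have "b \<in> nodes H" using multigraph_ends_neq(3)[OF mg _ g(2)] g(1) T(1) by blast
      ultimately show "b \<in> W" by (rule AW)
    qed
    moreover have "v \<notin> W" using WA A(3) by blast
    ultimately show ?thesis using True by simp
  qed
  then show "v \<in> reachable_set \<O> u \<longleftrightarrow> e \<notin> T"
    "e \<in> T \<Longrightarrow> cut_edge (ends H) T e (reachable_set \<O> u)"
    unfolding W W_def by blast+
qed

lemma restrict_tree_divisor_induced:
  assumes "sub_multigraph H G" "S \<subseteq> nodes H" "spanning_tree_of (induced H S) T"
  shows "S \<subseteq> U \<Longrightarrow> restrict_divisor (\<phi> es (induced H S) T) U = \<phi> es (induced H S) T"
    and "S \<inter> U = {} \<Longrightarrow> restrict_divisor (\<phi> es (induced H S) T) U = 0"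
proof -
  let ?E = "edges (induced H S) - T"
  note sub = sub_multigraph_induced[OF assms(1,2)]
  have fin: "finite ?E"
    using sub_multigraphD(1)[OF assms(1)] by (simp add: multigraph_def)
  have S: "chip_vertex es (induced H S) T f \<in> S" if "f \<in> ?E" for f
    using chip_vertex_in_ends[OF sub assms(3) that] that by auto
  show "restrict_divisor (\<phi> es (induced H S) T) U = \<phi> es (induced H S) T" if "S \<subseteq> U"
  proof -
    have "{f \<in> ?E. chip_vertex es (induced H S) T f \<in> U} = ?E" using S that by blast
    then show ?thesis unfolding tree_divisor_def restrict_divisor_sum_chip[OF fin] by (rule arg_cong)
  qed
  show "restrict_divisor (\<phi> es (induced H S) T) U = 0" if "S \<inter> U = {}"
  proof -
    have none: "{f \<in> ?E. chip_vertex es (induced H S) T f \<in> U} = {}" using S that by blast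
    show ?thesis unfolding tree_divisor_def restrict_divisor_sum_chip[OF fin] none by (rule sum.empty)
  qed
qed

text \<open>By \<open>inv_choice_tree\<close> the case taken in any derivation is the one dictated
  by \<open>e \<in> T\<close> or \<open>e \<notin> T\<close>, and the calls are made at the divisors
  of the corresponding parts of \<open>T\<close>. This yields injectivity of
  \<open>\<phi> es H\<close>.\<close>

lemma inv_returns_tree_divisor:
  "inv_returns es H D X \<Longrightarrow> sub_multigraph H G \<Longrightarrow> spanning_tree_of H T \<Longrightarrow> D = \<phi> es H T \<Longrightarrow> X = T"
proof (induction arbitrary: T rule: inv_returns.induct)
  case (zero H)
  note mg = sub_multigraphD(1)[OF zero.prems(1)]
  have "edges H - T = {}"
    by (rule sum_chip_eq_0D[OF _ zero.prems(3)[symmetric, unfolded tree_divisor_def]])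
      (use mg in \<open>simp add: multigraph_def\<close>)
  then show ?case using spanning_tree_ofD(1)[OF mg zero.prems(2)] by blast
next
  case (b1 H D H' D' X)
  note mg = sub_multigraphD(1)[OF b1.prems(1)]
  obtain u e v \<O> where b: "inv_choice es H D (u, e, v) \<O>" "v \<in> reachable_set \<O> u"
    "H' = delete_edge H e" "D' = D - chip v"
    using b1.hyps(1) by (rule inv_b1E)
  have e: "e \<notin> T"
    using inv_choice_tree(1)[OF b1.prems(1,2)] b(1,2) b1.prems(3) by blast
  have "D' = \<phi> es H' T"
    unfolding b(3,4) b1.prems(3)
      tree_divisor_delete_edge[OF b1.prems(1,2) e inv_choiceD(1)[OF b1.prems(1) b(1)]]
    by (rule add_diff_cancel_right')
  moreover have "spanning_tree_of H' T"
    using spanning_tree_delete_edge[OF mg] b1.prems(2) e b(3) by simp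
  ultimately show ?case using b1.IH b1_call(1)[OF b1.prems(1) b1.hyps(1)] by blast
next
  case (b2 H D e H\<^sub>L D\<^sub>L H\<^sub>R D\<^sub>R T\<^sub>L T\<^sub>R)
  note mg = sub_multigraphD(1)[OF b2.prems(1)]
  obtain u v \<O> U where b: "inv_choice es H D (u, e, v) \<O>" "U = reachable_set \<O> u" "v \<notin> U"
    "H\<^sub>L = induced H U"
    "D\<^sub>L = restrict_divisor D U -
      (\<Sum>f\<in>{f \<in> edges H. f \<noteq> e \<and> tail \<O> f \<notin> U \<and> head \<O> f \<in> U}. chip (head \<O> f))"
    "H\<^sub>R = induced H (nodes H - U)" "D\<^sub>R = restrict_divisor D (nodes H - U)"
    using b2.hyps(1) by (rule inv_b2E)
  let ?R = "nodes H - U" and ?X = "{f \<in> edges H. f \<noteq> e \<and> tail \<O> f \<notin> U \<and> head \<O> f \<in> U}"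
  let ?TL = "T \<inter> edges (induced H U)" and ?TR = "T \<inter> edges (induced H ?R)"
  note c = inv_choiceD[OF b2.prems(1) b(1)]
  have U: "U \<subseteq> nodes H" unfolding b(2) by (rule reachable_set_subset[OF mg c(2)])
  have u: "u \<in> U" using c(10) b(2) by simp
  have e: "e \<in> T"
    using inv_choice_tree(1)[OF b2.prems(1,2)] b(1-3) b2.prems(3) by blast
  have cut: "cut_edge (ends H) T e U"
    using inv_choice_tree(2)[OF b2.prems(1,2) _ e] b(1,2) b2.prems(3) by blast
  have closed: "\<forall>g\<in>edges H. tail \<O> g \<in> U \<longrightarrow> head \<O> g \<in> U"
    using reachable_set_closed[OF mg c(2)] by (simp add: b(2))
  note split = tree_divisor_split[OF b2.prems(1,2) e c(1) U cut u b(3) c(2) closed]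
  have fin: "finite ?X" using mg by (simp add: multigraph_def)
  have R: "?R \<subseteq> nodes H" "U \<inter> ?R = {}" "?R \<inter> U = {}" by auto
  have "{f \<in> ?X. head \<O> f \<in> U} = ?X" "{f \<in> ?X. head \<O> f \<in> ?R} = {}" by auto
  then have X: "restrict_divisor (\<Sum>f\<in>?X. chip (head \<O> f)) U = (\<Sum>f\<in>?X. chip (head \<O> f))"
    "restrict_divisor (\<Sum>f\<in>?X. chip (head \<O> f)) ?R = 0"
    by (simp_all only: restrict_divisor_sum_chip[OF fin] sum.empty)
  have D: "D = \<phi> es (induced H U) ?TL + \<phi> es (induced H ?R) ?TR + (\<Sum>f\<in>?X. chip (head \<O> f))"
    using b2.prems(3) split(1) by (rule trans)
  note L = restrict_tree_divisor_induced[OF b2.prems(1) U split(2)]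
  note R' = restrict_tree_divisor_induced[OF b2.prems(1) R(1) split(3)]
  \<comment> \<open>On \<open>U\<close> the divisor of the right part vanishes, and the crossing
    chips, all of them in \<open>U\<close>, are subtracted.\<close>
  have "D\<^sub>L = \<phi> es H\<^sub>L ?TL"
    by (simp only: b(4,5) D restrict_divisor_add X L(1)[OF subset_refl] R'(2)[OF R(3)]
        add_0_right add_diff_cancel_right')
  moreover have "D\<^sub>R = \<phi> es H\<^sub>R ?TR"
    by (simp only: b(6,7) D restrict_divisor_add X L(2)[OF R(2)] R'(1)[OF subset_refl]
        add_0_left add_0_right)
  ultimately have "T\<^sub>L = ?TL" "T\<^sub>R = ?TR"
    using b2.IH b2_call[OF b2.prems(1) b2.hyps(1)] split(2,3) b(4,6) by blast+
  moreover have "T \<subseteq> {e} \<union> ?TL \<union> ?TR"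
  proof
    fix g assume g: "g \<in> T"
    then have gH: "g \<in> edges H" using spanning_tree_ofD(1)[OF mg b2.prems(2)] by blast
    obtain x y where xy: "ends H g = {x, y}" "x \<in> nodes H" "y \<in> nodes H"
      by (rule multigraph_ends[OF mg gH])
    show "g \<in> {e} \<union> ?TL \<union> ?TR"
      using cut_edgeD[OF cut g _ xy(1)] xy g gH by auto
  qed
  ultimately show ?case using e by blast
qed

text \<open>Any result \<open>X\<close> satisfies \<open>\<phi> es H X = D\<close> by correctness,
  and then every result for this divisor is \<open>X\<close>.\<close>

lemma inv_returns_unique:
  assumes "sub_multigraph H G" "break_divisor H D"
  shows "\<exists>!T. inv_returns es H D T"
  using inv_returns_exists[OF assms] inv_returns_correct[OF _ assms]
    inv_returns_tree_divisor[OF _ assms(1)] by metis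

lemma inv_returns_Inv:
  "sub_multigraph H G \<Longrightarrow> break_divisor H D \<Longrightarrow> inv_returns es H D (Inv es H D)"
  unfolding Inv_def by (rule theI'[OF inv_returns_unique])

lemma Inv_correct:
  assumes "sub_multigraph H G" "break_divisor H D"
  shows "spanning_tree_of H (Inv es H D)" "\<phi> es H (Inv es H D) = D"
  using inv_returns_correct[OF inv_returns_Inv[OF assms] assms] by simp_all

lemma Inv_tree_divisor:
  assumes "sub_multigraph H G" "spanning_tree_of H T"
  shows "Inv es H (\<phi> es H T) = T"
  by (rule inv_returns_tree_divisor[OF inv_returns_Inv assms refl])
    (use assms break_divisor_tree_divisor in auto)

lemma inv_well_defined:
  assumes "sub_multigraph H G" "break_divisor H D"
  shows "inv_well_defined G es H D"
  unfolding inv_well_defined_def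
proof (intro conjI allI impI)
  show "\<exists>d \<O>. inv_choice es H D d \<O>" if "D \<noteq> 0"
    using inv_choice_exists[OF assms that] by metis
  show "Wellfounded.accp (inv_call es) (H, D)" by (rule inv_call_terminates[OF assms(1)])
  show "\<exists>!T. inv_returns es H D T" by (rule inv_returns_unique[OF assms])
  show "sub_multigraph H' G" "connected_graph H'" "break_divisor H' D'"
    if "inv_call es (H', D') (H, D)" for H' D'
    using inv_call_sub[OF assms(1) that] by simp_all
qed

end

theorem theorem4p2:
  fixes G H :: "('v, 'e) mgraph" and F :: "'e set" and es :: "('v, 'e) dart list"
  assumes "multigraph G"
    and "forest_of G F"
    and "oriented_enumeration G F es"
    and "sub_multigraph H G" and "connected_graph H"
  shows "(\<forall>D. break_divisor H D \<longrightarrow>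
            inv_well_defined G es H D \<and>
            spanning_tree_of H (Inv es H D) \<and> \<phi> es H (Inv es H D) = D) \<and>
         bij_betw (\<phi> es H) {T. spanning_tree_of H T} {D. break_divisor H D} \<and>
         (\<forall>T. spanning_tree_of H T \<longrightarrow> Inv es H (\<phi> es H T) = T)"
proof -
  interpret enumerated_multigraph G F es
    using assms(1-3) by (rule enumerated_multigraph.intro)
  note Inv = Inv_correct[OF assms(4)] Inv_tree_divisor[OF assms(4)]
  have "bij_betw (\<phi> es H) {T. spanning_tree_of H T} {D. break_divisor H D}"
    by (rule bij_betw_byWitness[of _ "Inv es H"])
      (use Inv break_divisor_tree_divisor[OF assms(4)] in auto)
  with Inv inv_well_defined[OF assms(4)] show ?thesis by blast
qed

end
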